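(* Let $0=t_0<t_1<\ldots<t_s=1$ be a partition of the interval $[0,1]$ and put $\Delta t_{i-1}:=t_i-t_{i-1}$. Let $P(t)$ ($t\in[0,1]$) be a piecewise polynomial function which in the interval $[t_{i-1},t_i]$ ($i=1,2,\ldots,s$) reduces to a polynomial $P^i(t)$ of degree $n_i$ with Bézier coefficients $p^i_j$ ($i=1,2,\ldots,s$; $j=0,1,\ldots,n_i$), i.e. $$P(t)=P^i(t):=\sum_{j=0}^{n_i}p^i_j\,B^{n_i}_j\!\left(\frac{t-t_{i-1}}{\Delta t_{i-1}}\right)\qquad (t_{i-1}\le t\le t_i).$$ Let $m\ge\max_i n_i$, and let $k,l$ be nonnegative integers with $k\le n_1+1$, $l\le n_s+1$ and $k+l\le m$. Then the coefficients $r_0,r_1,\ldots,r_m$ of the polynomial $$R(t)=\sum_{j=0}^m r_j B^m_j(t)\qquad(0\le t\le 1)$$ minimizing the error $$\|R-P\|_{L_2}^2:=\langle R-P,R-P\rangle$$ with the constraints $$R^{(i)}(0)=P^{(i)}(0)\quad(i=0,1,\ldots,k-1),\qquad R^{(j)}(1)=P^{(j)}(1)\quad(j=0,1,\ldots,l-1)$$ are given by $$r_j=\binom{n_1}{j}\binom{m}{j}^{-1}\Delta^jp^1_0-\sum_{h=0}^{j-1}(-1)^{j+h}\binom{j}{h}r_h\qquad(j=0,1,\ldots,k-1),$$ $$r_{m-j}=(-1)^j\binom{n_s}{j}\binom{m}{j}^{-1}\Delta^jp^s_{n_s-j}-\sum_{h=1}^{j}(-1)^h\binom{j}{h}r_{m-j+h}\qquad(j=0,1,\ldots,l-1),$$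 $$r_j=\sum_{h=k}^{m-l}\hat r_h\,c_{hj}(m,k,l)\qquad(j=k,k+1,\ldots,m-l),$$ where $$\hat r_h:=\sum_{i=1}^{s}\Delta t_{i-1}\sum_{v=0}^{m}\hat p^i_v\,d^{(i)}_{hv}-\frac{1}{2m+1}\binom{m}{h}\left(\sum_{v=0}^{k-1}+\sum_{v=m-l+1}^{m}\right)\binom{2m}{h+v}^{-1}\binom{m}{v}r_v,$$ $$\hat p^i_v:=\frac{1}{m+n_i+1}\binom{m}{v}\sum_{q=0}^{n_i}\binom{m+n_i}{q+v}^{-1}\binom{n_i}{q}p^i_q,$$ with $c_{hj}(m,k,l)$ and $d^{(i)}_{hv}$ as defined in the context.
   Context: Bernstein basis polynomials of degree $n$: $B^n_j(t):=\binom nj t^j(1-t)^{n-j}$ for $0\le j\le n$, with $B^n_j:=0$ for $j<0$ or $j>n$ (and $0^0=1$). The inner product is $\langle f,g\rangle:=\int_0^1 f(t)g(t)\,dt$. Forward differences act on the lower index: $\Delta^0c_h:=c_h$, $\Delta^jc_h:=\Delta^{j-1}c_{h+1}-\Delta^{j-1}c_h$ ($j=1,2,\ldots$); thus $\Delta^j p^1_0$ and $\Delta^jp^s_{n_s-j}$ are differences of the sequences $(p^1_h)_h$ and $(p^s_h)_h$. (The symbol $\Delta t_{i-1}$ denotes $t_i-t_{i-1}$.) Let $\Pi_m^{(k,l)}$ be the space of real polynomials $Q$ of degree at most $m$ with $Q^{(i)}(0)=0$ for $0\le i\le k-1$ and $Q^{(j)}(1)=0$ for $0\le j\le l-1$;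 it has basis $B^m_k,\ldots,B^m_{m-l}$. The constrained dual Bernstein basis $D^{(m,k,l)}_k,\ldots,D^{(m,k,l)}_{m-l}$ is the unique family in $\Pi_m^{(k,l)}$ with $\langle D^{(m,k,l)}_i,B^m_j\rangle=\delta_{ij}$ for $i,j=k,\ldots,m-l$, where $\delta_{ij}$ is $1$ if $i=j$ and $0$ otherwise. The numbers $c_{ij}(m,k,l)$ are the coefficients in $$D^{(m,k,l)}_i=\sum_{j=k}^{m-l}c_{ij}(m,k,l)B^m_j\qquad(k\le i\le m-l).$$ The numbers $d^{(i)}_{jh}$ ($i=1,\ldots,s$; $0\le j,h\le m$) are $$d^{(i)}_{jh}:=\sum_{v=0}^{h}B^{m-h}_{j-v}(t_{i-1})\,B^h_v(t_i).$$ Empty sums are $0$; $\left(\sum_{v=0}^{k-1}+\sum_{v=m-l+1}^{m}\right)x_v$ means $\sum_{v=0}^{k-1}x_v+\sum_{v=m-l+1}^{m}x_v$.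
   Formalization: The first terms of the formulas for r_j (j<k) and r_{m-j} (j<l) need extra factors (Δt_0)^{-j} and (Δt_{s-1})^{-j}; as printed they fail, e.g. P(t)=t, t_1=1/2, n_1=n_2=1, m=k=2, l=0 gives r_1=1/4, not 1/2. *)

theory Defs
  imports "HOL-Analysis.Analysis" "HOL-Computational_Algebra.Polynomial"
begin

text \<open>
  The basis polynomials are the library's \<^const>\<open>Bernstein\<close>, with natural-number indices;
  \<open>Bernstein n j = 0\<close> for \<open>j > n\<close> since then \<open>n choose j = 0\<close>. Negative lower indices
  are excluded explicitly where they could arise.
\<close>

definition inner01 :: "(real \<Rightarrow> real) \<Rightarrow> (real \<Rightarrow> real) \<Rightarrow> real" where
  "inner01 f g = integral {0..1} (\<lambda>t. f t * g t)"

definition bezier :: "nat \<Rightarrow> (nat \<Rightarrow> real) \<Rightarrow> real \<Rightarrow> real" where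
  "bezier n p t = (\<Sum>j\<le>n. p j * Bernstein n j t)"

text \<open>
  The \<open>i\<close>-th derivative of a function on \<open>[0,1]\<close>, one-sided at the end points. For a piecewise
  polynomial, the values at 0 and 1 depend only on the first and the last piece; the (arbitrary)
  value at an interior breakpoint where the function is not differentiable does not matter.
\<close>
definition nderiv01 :: "nat \<Rightarrow> (real \<Rightarrow> real) \<Rightarrow> real \<Rightarrow> real" where
  "nderiv01 i f = ((\<lambda>g x. vector_derivative g (at x within {0..1})) ^^ i) f"

primrec fdiff :: "nat \<Rightarrow> (nat \<Rightarrow> real) \<Rightarrow> nat \<Rightarrow> real" where
  "fdiff 0 c h = c h"
| "fdiff (Suc j) c h = fdiff j c (Suc h) - fdiff j c h"

definition constrained_polys :: "nat \<Rightarrow> nat \<Rightarrow> nat \<Rightarrow> real poly set" where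
  "constrained_polys m k l =
     {Q. degree Q \<le> m \<and> (\<forall>i<k. poly ((pderiv ^^ i) Q) 0 = 0)
                     \<and> (\<forall>j<l. poly ((pderiv ^^ j) Q) 1 = 0)}"

text \<open>Meaningful for \<open>k + l \<le> m\<close> and \<open>k \<le> i \<le> m - l\<close>.\<close>
definition dual_bernstein :: "nat \<Rightarrow> nat \<Rightarrow> nat \<Rightarrow> nat \<Rightarrow> real poly" where
  "dual_bernstein m k l i =
     (THE Q. Q \<in> constrained_polys m k l \<and>
        (\<forall>j\<in>{k..m - l}. inner01 (poly Q) (Bernstein m j) = (if i = j then 1 else 0)))"

text \<open>The coefficients are set to 0 outside \<open>{k..m - l}\<close> so that the sequence is unique.\<close>
definition dual_coeff :: "nat \<Rightarrow> nat \<Rightarrow> nat \<Rightarrow> nat \<Rightarrow> nat \<Rightarrow> real" where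
  "dual_coeff m k l i =
     (THE a. (\<forall>j. j \<notin> {k..m - l} \<longrightarrow> a j = 0) \<and>
        (\<forall>t. poly (dual_bernstein m k l i) t = (\<Sum>j=k..m - l. a j * Bernstein m j t)))"

text \<open>\<open>d_coeff m t i j h\<close> is \<open>d\<^bsup>(i)\<^esup>\<^bsub>jh\<^esub>\<close>; the terms with \<open>j - v < 0\<close> vanish.\<close>
definition d_coeff :: "nat \<Rightarrow> (nat \<Rightarrow> real) \<Rightarrow> nat \<Rightarrow> nat \<Rightarrow> nat \<Rightarrow> real" where
  "d_coeff m t i j h =
     (\<Sum>v\<le>h. (if v \<le> j then Bernstein (m - h) (j - v) (t (i - 1)) else 0) * Bernstein h v (t i))"

text \<open>In the following, \<open>p i j\<close> is the \<open>j\<close>-th Bezier coefficient of the \<open>i\<close>-th segment, of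
  degree \<open>n i\<close>, for \<open>i = 1, \<dots>, s\<close>.\<close>

definition p_hat :: "nat \<Rightarrow> (nat \<Rightarrow> nat) \<Rightarrow> (nat \<Rightarrow> nat \<Rightarrow> real) \<Rightarrow> nat \<Rightarrow> nat \<Rightarrow> real" where
  "p_hat m n p i v =
     1 / real (m + n i + 1) * real (m choose v) *
     (\<Sum>q\<le>n i. inverse (real ((m + n i) choose (q + v))) * real (n i choose q) * p i q)"

definition r_hat :: "nat \<Rightarrow> nat \<Rightarrow> nat \<Rightarrow> nat \<Rightarrow> (nat \<Rightarrow> real) \<Rightarrow> (nat \<Rightarrow> nat) \<Rightarrow>
    (nat \<Rightarrow> nat \<Rightarrow> real) \<Rightarrow> (nat \<Rightarrow> real) \<Rightarrow> nat \<Rightarrow> real" where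
  "r_hat m k l s t n p r h =
     (\<Sum>i=1..s. (t i - t (i - 1)) * (\<Sum>v\<le>m. p_hat m n p i v * d_coeff m t i h v))
     - 1 / real (2 * m + 1) * real (m choose h) *
       ((\<Sum>v<k. inverse (real ((2 * m) choose (h + v))) * real (m choose v) * r v)
        + (\<Sum>v=m - l + 1..m. inverse (real ((2 * m) choose (h + v))) * real (m choose v) * r v))"

definition feasible :: "nat \<Rightarrow> nat \<Rightarrow> nat \<Rightarrow> (real \<Rightarrow> real) \<Rightarrow> (nat \<Rightarrow> real) \<Rightarrow> bool" where
  "feasible m k l P r \<longleftrightarrow>
     (\<forall>i<k. nderiv01 i (bezier m r) 0 = nderiv01 i P 0) \<and>
     (\<forall>j<l. nderiv01 j (bezier m r) 1 = nderiv01 j P 1)"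

definition sq_error :: "nat \<Rightarrow> (real \<Rightarrow> real) \<Rightarrow> (nat \<Rightarrow> real) \<Rightarrow> real" where
  "sq_error m P r = inner01 (\<lambda>t. bezier m r t - P t) (\<lambda>t. bezier m r t - P t)"

definition optimal :: "nat \<Rightarrow> nat \<Rightarrow> nat \<Rightarrow> (real \<Rightarrow> real) \<Rightarrow> (nat \<Rightarrow> real) \<Rightarrow> bool" where
  "optimal m k l P r \<longleftrightarrow>
     feasible m k l P r \<and> (\<forall>r'. feasible m k l P r' \<longrightarrow> sq_error m P r \<le> sq_error m P r')"

text \<open>
  Coefficients fixed by the interpolation conditions at 0 and 1. As
  \<open>P\<^sup>1(t) = bezier (n 1) (p 1) ((t - t 0) / (t 1 - t 0))\<close>, the chain rule gives
  \<open>P\<^bsup>(j)\<^esup>(0) = n\<^sub>1! / (n\<^sub>1 - j)! * \<Delta>\<^sup>j p\<^sup>1\<^sub>0 / (t 1 - t 0)\<^sup>j\<close>, and similarly at 1; hence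
  the powers of the segment lengths. Without them the formulas fail in general: for \<open>P t = t\<close> with
  \<open>s = 2\<close>, \<open>t 1 = 1/2\<close>, \<open>n 1 = n 2 = 1\<close>, \<open>m = k = 2\<close>, \<open>l = 0\<close>
  they would give \<open>r 1 = 1/4\<close> instead of \<open>1/2\<close>.
\<close>
definition left_coeffs :: "nat \<Rightarrow> nat \<Rightarrow> (nat \<Rightarrow> real) \<Rightarrow> (nat \<Rightarrow> nat) \<Rightarrow>
    (nat \<Rightarrow> nat \<Rightarrow> real) \<Rightarrow> (nat \<Rightarrow> real) \<Rightarrow> bool" where
  "left_coeffs m k t n p r \<longleftrightarrow>
     (\<forall>j<k. r j = real (n 1 choose j) * inverse (real (m choose j))
                    * inverse ((t 1 - t 0) ^ j) * fdiff j (p 1) 0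
                  - (\<Sum>h<j. (-1) ^ (j + h) * real (j choose h) * r h))"

definition right_coeffs :: "nat \<Rightarrow> nat \<Rightarrow> nat \<Rightarrow> (nat \<Rightarrow> real) \<Rightarrow> (nat \<Rightarrow> nat) \<Rightarrow>
    (nat \<Rightarrow> nat \<Rightarrow> real) \<Rightarrow> (nat \<Rightarrow> real) \<Rightarrow> bool" where
  "right_coeffs m l s t n p r \<longleftrightarrow>
     (\<forall>j<l. r (m - j) = (-1) ^ j * real (n s choose j) * inverse (real (m choose j))
                          * inverse ((t s - t (s - 1)) ^ j) * fdiff j (p s) (n s - j)
                        - (\<Sum>h=1..j. (-1) ^ h * real (j choose h) * r (m - j + h)))"

end

theory Submission
  imports Defs
begin

text \<open>
  Differentiating \<open>j\<close> times turns Bernstein coefficients into \<open>j\<close>-th forward differences, so the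
  interpolation conditions at 0 and 1 form two triangular systems that fix the outer coefficients
  of \<open>R\<close>; the inner ones remain free. Minimality is then orthogonality of \<open>R - P\<close> to
  \<open>B\<^sup>m\<^sub>k, \<dots>, B\<^sup>m\<^sub>m\<^sub>-\<^sub>l\<close>. This is a linear system with the Gram matrix of these polynomials, whose
  inverse has the entries \<open>c\<^sub>h\<^sub>j\<close>, and its right-hand side is \<open>\<langle>P, B\<^sup>m\<^sub>h\<rangle>\<close> minus the contribution of
  the outer coefficients. To compute \<open>\<langle>P, B\<^sup>m\<^sub>h\<rangle>\<close> segment by segment, \<open>B\<^sup>m\<^sub>h\<close> is re-expanded in the
  Bernstein basis of the segment, which produces the coefficients \<open>d\<^sub>h\<^sub>v\<close>.
\<close>

subsection \<open>Derivatives of Bernstein expansions\<close>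

text \<open>Formal polynomials in place of functions, so that \<open>pderiv\<close>, degree bounds
  and root counting apply.\<close>

definition bern_poly :: "nat \<Rightarrow> nat \<Rightarrow> real poly" where
  "bern_poly n j = smult (real (n choose j)) ([:0, 1:] ^ j * [:1, -1:] ^ (n - j))"

definition bezier_poly :: "nat \<Rightarrow> (nat \<Rightarrow> real) \<Rightarrow> real poly" where
  "bezier_poly n r = (\<Sum>j\<le>n. smult (r j) (bern_poly n j))"

lemma poly_bern_poly [simp]: "poly (bern_poly n j) x = Bernstein n j x"
  by (simp add: bern_poly_def Bernstein_def)

lemma poly_bezier_poly [simp]: "poly (bezier_poly n r) x = bezier n r x"
  by (simp add: bezier_poly_def bezier_def poly_sum)

lemma Bernstein_eq_0: "n < j \<Longrightarrow> Bernstein n j x = 0"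
  by (simp add: Bernstein_def)

lemma degree_bern_poly_le: "degree (bern_poly n j) \<le> n"
proof (cases "j \<le> n")
  case True
  have "degree ([:0, 1:] ^ j * [:1, -1:] ^ (n - j) :: real poly) \<le> j + (n - j)"
    by (rule order_trans[OF degree_mult_le add_mono])
       (rule order_trans[OF degree_power_le], simp)+
  with True show ?thesis
    unfolding bern_poly_def by (intro order_trans[OF degree_smult_le]) simp
qed (simp add: bern_poly_def)

lemma degree_bezier_poly_le: "degree (bezier_poly n r) \<le> n"
  unfolding bezier_poly_def
  by (intro degree_sum_le) (auto intro: order_trans[OF degree_smult_le] degree_bern_poly_le)

lemma pderiv_bern_poly_0:
  "pderiv (bern_poly (Suc n) 0) = smult (- real (Suc n)) (bern_poly n 0)"
  by (simp add: bern_poly_def pderiv_power_Suc pderiv_smult pderiv_pCons mult.commute del: power_Suc of_nat_Suc)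

text \<open>Product rule plus absorption: each exponent brought down merges with the binomial
  coefficient into \<open>Suc n\<close> times one of upper index \<open>n\<close>. Lower index 0 is
  treated separately, since its left neighbour would have index -1.\<close>

lemma pderiv_bern_poly_Suc:
  "pderiv (bern_poly (Suc n) (Suc j)) =
     smult (real (Suc n)) (bern_poly n j - bern_poly n (Suc j))"
proof -
  have abs1: "real (Suc n choose Suc j) * real (Suc j) = real (Suc n) * real (n choose j)"
    by (metis Suc_times_binomial mult.commute of_nat_mult)
  have "poly (pderiv (bern_poly (Suc n) (Suc j))) x =
        poly (smult (real (Suc n)) (bern_poly n j - bern_poly n (Suc j))) x" for x
  proof (cases "j < n")
    case True
    then obtain d where d: "n = Suc (j + d)" using less_iff_Suc_add by blast
    have abs2: "real (Suc n choose Suc j) * real (Suc d) = real (Suc n) * real (n choose Suc j)"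
      using binomial_absorb_comp[of "Suc n" "Suc j"] d
      by (metis Suc_diff_Suc True add_diff_cancel_left' diff_Suc_1 diff_Suc_Suc mult.commute of_nat_mult)
    have *: "poly (pderiv (bern_poly (Suc n) (Suc j))) x =
      (real (Suc n choose Suc j) * real (Suc j)) * x ^ j * (1 - x) ^ Suc d
      - (real (Suc n choose Suc j) * real (Suc d)) * x ^ Suc j * (1 - x) ^ d"
      by (simp add: bern_poly_def d pderiv_mult pderiv_smult pderiv_power_Suc pderiv_pCons
          algebra_simps del: power_Suc of_nat_Suc binomial_Suc_Suc)
    show ?thesis
      unfolding * abs1 abs2 by (simp add: Bernstein_def d algebra_simps del: of_nat_Suc binomial_Suc_Suc)
  next
    \<comment> \<open>With \<open>j = n\<close> the factor \<open>1 - x\<close> is absent; with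
      \<open>j > n\<close> both sides are 0.\<close>
    case False
    then consider "j = n" | "j > n" by linarith
    then show ?thesis
    proof cases
      case 1
      then show ?thesis
        by (simp add: bern_poly_def Bernstein_def pderiv_power_Suc pderiv_smult pderiv_pCons del: power_Suc of_nat_Suc)
    next
      case 2
      then show ?thesis by (simp add: bern_poly_def Bernstein_def binomial_eq_0 del: binomial_Suc_Suc)
    qed
  qed
  then show ?thesis by (simp add: poly_eq_poly_eq_iff[symmetric] fun_eq_iff)
qed

lemma pderiv_sum: "pderiv (sum f A) = (\<Sum>x\<in>A. pderiv (f x))"
  by (induction A rule: infinite_finite_induct) (auto simp: pderiv_add)

text \<open>Summation by parts: collecting the terms with the same Bernstein polynomial moves the
  difference from the polynomials to the coefficients.\<close>

lemma pderiv_bezier_poly: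
  "pderiv (bezier_poly (Suc n) r) = smult (real (Suc n)) (bezier_poly n (\<lambda>j. r (Suc j) - r j))"
proof -
  have "poly (pderiv (bezier_poly (Suc n) r)) x =
      real (Suc n) * bezier n (\<lambda>j. r (Suc j) - r j) x" for x
  proof -
    let ?B = "\<lambda>j. r j * Bernstein n j x"
    \<comment> \<open>The term with index \<open>Suc n\<close> is 0, so the shifted sum and the term
      with index 0 make up the full sum.\<close>
    have *: "(\<Sum>j\<le>n. r (Suc j) * Bernstein n (Suc j) x) + ?B 0 = (\<Sum>j\<le>n. ?B j)"
      using sum.atMost_Suc_shift[of ?B n] by (simp add: Bernstein_eq_0 add.commute)
    have "poly (pderiv (bezier_poly (Suc n) r)) x =
      (\<Sum>j\<le>n. r (Suc j) * (real (Suc n) * (Bernstein n j x - Bernstein n (Suc j) x)))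
      - r 0 * (real (Suc n) * Bernstein n 0 x)"
      unfolding bezier_poly_def sum.atMost_Suc_shift
      by (simp add: pderiv_add pderiv_smult pderiv_bern_poly_0 pderiv_sum pderiv_bern_poly_Suc poly_sum mult.assoc
          del: of_nat_Suc)
    also have "\<dots> = real (Suc n) * ((\<Sum>j\<le>n. r (Suc j) * Bernstein n j x)
       - ((\<Sum>j\<le>n. r (Suc j) * Bernstein n (Suc j) x) + ?B 0))"
      by (simp add: sum_distrib_left right_diff_distrib distrib_left sum_subtractf
          mult.left_commute del: of_nat_Suc)
    also have "\<dots> = real (Suc n) * bezier n (\<lambda>j. r (Suc j) - r j) x"
      unfolding * by (simp add: bezier_def left_diff_distrib sum_subtractf)
    finally show ?thesis .
  qed
  then show ?thesis by (simp add: poly_eq_poly_eq_iff[symmetric] fun_eq_iff)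
qed

text \<open>The factors n, n - 1, ..., n - j + 1 multiply to a falling factorial. For
  \<open>j > n\<close> truncated subtraction would turn the right-hand side into a constant that
  need not vanish.\<close>

lemma higher_pderiv_bezier_poly:
  assumes "j \<le> n"
  shows "(pderiv ^^ j) (bezier_poly n r) = smult (fact n / fact (n - j)) (bezier_poly (n - j) (fdiff j r))"
  using assms
proof (induction j)
  case 0
  have "fdiff 0 r = r" by (simp add: fun_eq_iff)
  then show ?case by simp
next
  case (Suc j)
  then obtain d where d: "n = Suc (j + d)" by (metis Suc_le_eq less_iff_Suc_add)
  have f: "fdiff (Suc j) r = (\<lambda>i. fdiff j r (Suc i) - fdiff j r i)" by (simp add: fun_eq_iff)
  have "n - j = Suc d" "n - Suc j = d" using d by auto
  with Suc show ?case
    by (simp add: pderiv_smult pderiv_bezier_poly f field_simps del: of_nat_Suc fdiff.simps)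
qed

section \<open>Endpoint values and forward differences\<close>

lemma bezier_0 [simp]: "bezier n r 0 = r 0"
proof -
  have "bezier n r 0 = (\<Sum>j\<le>n. if j = 0 then r 0 else 0)"
    unfolding bezier_def by (rule sum.cong) (auto simp: Bernstein_def)
  then show ?thesis by simp
qed

lemma bezier_1 [simp]: "bezier n r 1 = r n"
proof -
  have "bezier n r 1 = (\<Sum>j\<le>n. if j = n then r n else 0)"
    unfolding bezier_def by (rule sum.cong) (auto simp: Bernstein_def)
  then show ?thesis by simp
qed

text \<open>Induction by Pascal's rule. The exponent \<open>j + i\<close> gives the sign of
  \<open>j - i\<close> without natural-number subtraction.\<close>

lemma fdiff_eq_sum: "fdiff j c h = (\<Sum>i\<le>j. (-1) ^ (j + i) * real (j choose i) * c (h + i))"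
proof (induction j arbitrary: h)
  case (Suc j)
  let ?g = "\<lambda>i. (-1) ^ (j + i) * real (j choose i) * c (h + i)"
  have 1: "(\<Sum>i\<le>Suc j. (-1) ^ (Suc j + i) * real (Suc j choose i) * c (h + i)) =
    (\<Sum>i\<le>j. (-1) ^ (j + i) * real (j choose i) * c (Suc h + i)) +
    ((-1) ^ Suc j * c h + (\<Sum>i\<le>j. (-1) ^ (j + i) * real (j choose Suc i) * c (Suc h + i)))"
    unfolding sum.atMost_Suc_shift
    by (simp add: sum.distrib[symmetric] algebra_simps)
  have 2: "(-1) ^ Suc j * c h + (\<Sum>i\<le>j. (-1) ^ (j + i) * real (j choose Suc i) * c (Suc h + i))
      = - (\<Sum>i\<le>j. ?g i)"
  proof -
    have "(\<Sum>i\<le>j. ?g i) = (\<Sum>i\<le>Suc j. ?g i)" by simp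
    also have "\<dots> = (-1) ^ j * c h + (\<Sum>i\<le>j. ?g (Suc i))"
      unfolding sum.atMost_Suc_shift by simp
    finally show ?thesis by (simp add: sum_negf)
  qed
  show ?case unfolding 1 2 by (simp add: Suc.IH)
qed simp

text \<open>The coefficient of \<open>r j\<close> is 1, so prescribing the differences at 0 is a
  unit triangular system; this is the shape of the recursion in \<open>left_coeffs\<close>.\<close>

lemma fdiff_left: "fdiff j r 0 = r j + (\<Sum>h<j. (-1) ^ (j + h) * real (j choose h) * r h)"
proof -
  have "fdiff j r 0 = (\<Sum>h<Suc j. (-1) ^ (j + h) * real (j choose h) * r h)"
    by (simp add: fdiff_eq_sum lessThan_Suc_atMost)
  then show ?thesis by simp
qed

text \<open>Mirror image at the other end: here \<open>r (m - j)\<close> is the newest unknown, with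
  coefficient \<open>(-1) ^ j\<close>.\<close>

lemma fdiff_right:
  assumes "j \<le> m"
  shows "fdiff j r (m - j) = (-1) ^ j * (r (m - j) + (\<Sum>h=1..j. (-1) ^ h * real (j choose h) * r (m - j + h)))"
proof -
  have "fdiff j r (m - j) = (-1) ^ j * (\<Sum>h=0..j. (-1) ^ h * real (j choose h) * r (m - j + h))"
    by (simp add: fdiff_eq_sum atMost_atLeast0 sum_distrib_left power_add mult.assoc)
  also have "(\<Sum>h=0..j. (-1) ^ h * real (j choose h) * r (m - j + h)) =
    r (m - j) + (\<Sum>h=1..j. (-1) ^ h * real (j choose h) * r (m - j + h))"
    by (subst sum.atLeast_Suc_atMost) auto
  finally show ?thesis .
qed

text \<open>Forward substitution in the homogeneous triangular system.\<close>

lemma fdiff_left_0D: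
  assumes "\<And>i. i < k \<Longrightarrow> fdiff i r 0 = 0" "j < k"
  shows "r j = 0"
  using assms(2)
proof (induction j rule: less_induct)
  case (less j)
  then have "(\<Sum>h<j. (-1) ^ (j + h) * real (j choose h) * r h) = 0"
    by (intro sum.neutral) auto
  with fdiff_left[of j r] assms(1)[OF less.prems] show ?case by simp
qed

lemma fdiff_right_0D:
  assumes "\<And>i. i < l \<Longrightarrow> fdiff i r (m - i) = 0" "l \<le> Suc m" "j < l"
  shows "r (m - j) = 0"
  using assms(3)
proof (induction j rule: less_induct)
  case (less j)
  have "r (m - j + h) = 0" if "h \<in> {1..j}" for h
  proof -
    have "m - j + h = m - (j - h)" using that less.prems assms(2) by auto
    moreover have "j - h < j" using that by auto
    ultimately show ?thesis using less by (metis order.strict_trans)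
  qed
  then have "(\<Sum>h=1..j. (-1) ^ h * real (j choose h) * r (m - j + h)) = 0"
    by (intro sum.neutral) auto
  with fdiff_right[of j m r] assms(1)[OF less.prems] less.prems assms(2) show ?case by simp
qed

lemma higher_pderiv_bezier_0:
  "j \<le> n \<Longrightarrow> poly ((pderiv ^^ j) (bezier_poly n r)) 0 = fact n / fact (n - j) * fdiff j r 0"
  by (simp add: higher_pderiv_bezier_poly)

lemma higher_pderiv_bezier_1:
  "j \<le> n \<Longrightarrow> poly ((pderiv ^^ j) (bezier_poly n r)) 1 = fact n / fact (n - j) * fdiff j r (n - j)"
  by (simp add: higher_pderiv_bezier_poly)

section \<open>Linear independence and spanning of the Bernstein basis\<close>

lemma bezier_zero_imp_coeff_zero:
  assumes "\<And>x. x \<in> {0..1} \<Longrightarrow> bezier m r x = 0" and "j \<le> m"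
  shows "r j = 0"
proof -
  \<comment> \<open>Infinitely many roots in [0,1] force the zero polynomial; its derivatives at 0
    then vanish, and these determine the coefficients by the triangular system.\<close>
  have "bezier_poly m r = 0"
  proof (rule ccontr)
    assume "bezier_poly m r \<noteq> 0"
    then have "finite {x. poly (bezier_poly m r) x = 0}" by (rule poly_roots_finite)
    moreover have "{0..1::real} \<subseteq> {x. poly (bezier_poly m r) x = 0}" using assms by auto
    ultimately show False by (meson finite_subset infinite_Icc zero_less_one)
  qed
  then have "fdiff i r 0 = 0" if "i < Suc m" for i
    using higher_pderiv_bezier_0[of i m r] that by simp
  then show ?thesis using fdiff_left_0D[of "Suc m" r j] assms(2) by simp
qed

text \<open>Each monomial up to degree \<open>m\<close> is expanded first; a general polynomial
  follows by linearity.\<close>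

lemma bezier_poly_surj:
  assumes "degree Q \<le> m"
  obtains r where "Q = bezier_poly m r"
proof -
  have mono: "\<exists>r. \<forall>x. x ^ i = bezier m r x" if "i \<le> m" for i
  proof (intro exI allI)
    fix x :: real
    let ?r = "\<lambda>j. if i \<le> j then real ((m - i) choose (j - i)) / real (m choose j) else 0"
    \<comment> \<open>A power of \<open>x + (1 - x) = 1\<close> lifts the degree to
      \<open>m\<close>; \<open>?r\<close> is read off from its binomial expansion.\<close>
    have "x ^ i = x ^ i * (x + (1 - x)) ^ (m - i)" by simp
    also have "\<dots> = (\<Sum>w\<le>m - i. real ((m - i) choose w) * x ^ (w + i) * (1 - x) ^ (m - i - w))"
      unfolding binomial_ring by (simp add: sum_distrib_left power_add algebra_simps)
    also have "\<dots> = (\<Sum>j\<in>{i..m}. ?r j * Bernstein m j x)"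
      by (rule sum.reindex_bij_witness[of _ "\<lambda>j. j - i" "\<lambda>w. w + i"])
         (use that in \<open>auto simp: Bernstein_def add.commute\<close>)
    also have "\<dots> = (\<Sum>j\<le>m. ?r j * Bernstein m j x)"
      by (rule sum.mono_neutral_left) auto
    finally show "x ^ i = bezier m ?r x" by (simp add: bezier_def)
  qed
  then obtain R where R: "\<And>i x. i \<le> m \<Longrightarrow> x ^ i = bezier m (R i) x" by metis
  have "poly Q x = poly (bezier_poly m (\<lambda>j. \<Sum>i\<le>m. coeff Q i * R i j)) x" for x
  proof -
    have "poly Q x = (\<Sum>i\<le>m. coeff Q i * x ^ i)"
      unfolding poly_altdef by (rule sum.mono_neutral_left) (use assms in \<open>auto simp: coeff_eq_0\<close>)
    also have "\<dots> = (\<Sum>i\<le>m. coeff Q i * bezier m (R i) x)" by (rule sum.cong) (simp_all add: R)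
    also have "\<dots> = bezier m (\<lambda>j. \<Sum>i\<le>m. coeff Q i * R i j) x"
      unfolding bezier_def sum_distrib_left sum_distrib_right
      by (subst sum.swap) (simp add: mult.assoc)
    finally show ?thesis by simp
  qed
  then show thesis by (intro that) (auto simp: poly_eq_poly_eq_iff[symmetric] fun_eq_iff)
qed

text \<open>At each end the derivative conditions say that the first \<open>k\<close> or
  \<open>l\<close> differences vanish; triangularity turns this into vanishing outer
  coefficients.\<close>

lemma constrained_polys_iff:
  assumes "k + l \<le> m"
  shows "Q \<in> constrained_polys m k l \<longleftrightarrow>
    (\<exists>r. Q = bezier_poly m r \<and> (\<forall>j. j \<notin> {k..m - l} \<longrightarrow> r j = 0))"
proof
  assume Q: "Q \<in> constrained_polys m k l"
  then obtain r where r: "Q = bezier_poly m r"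
    unfolding constrained_polys_def by (auto elim: bezier_poly_surj)
  have "fdiff i r 0 = 0" if "i < k" for i
    using Q higher_pderiv_bezier_0[of i m r] that assms by (auto simp: constrained_polys_def r)
  then have a: "r j = 0" if "j < k" for j using fdiff_left_0D that by blast
  have "fdiff i r (m - i) = 0" if "i < l" for i
    using Q higher_pderiv_bezier_1[of i m r] that assms by (auto simp: constrained_polys_def r)
  then have b: "r (m - j) = 0" if "j < l" for j using fdiff_right_0D[of l r m j] that assms by auto
  \<comment> \<open>Entries of \<open>r\<close> beyond \<open>m\<close> do not enter the polynomial
    and may be nonzero, hence the truncation.\<close>
  let ?r = "\<lambda>j. if j \<in> {k..m - l} then r j else 0"
  have "r j = ?r j" if "j \<le> m" for j
    using a[of j] b[of "m - j"] that assms by auto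
  then have "Q = bezier_poly m ?r" unfolding r bezier_poly_def by (intro sum.cong) auto
  then show "\<exists>r. Q = bezier_poly m r \<and> (\<forall>j. j \<notin> {k..m - l} \<longrightarrow> r j = 0)"
    by (intro exI[of _ ?r]) auto
next
  assume "\<exists>r. Q = bezier_poly m r \<and> (\<forall>j. j \<notin> {k..m - l} \<longrightarrow> r j = 0)"
  then obtain r where r: "Q = bezier_poly m r" "\<And>j. j \<notin> {k..m - l} \<Longrightarrow> r j = 0" by blast
  have "fdiff i r 0 = 0" if "i < k" for i
    unfolding fdiff_eq_sum by (rule sum.neutral) (use that in \<open>auto simp: r(2)\<close>)
  moreover have "fdiff i r (m - i) = 0" if "i < l" for i
    unfolding fdiff_eq_sum by (rule sum.neutral) (use that assms in \<open>auto intro!: r(2)\<close>)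
  ultimately show "Q \<in> constrained_polys m k l"
    using assms by (auto simp: constrained_polys_def r(1) degree_bezier_poly_le
        higher_pderiv_bezier_0 higher_pderiv_bezier_1)
qed

subsection \<open>The Gram matrix and the dual basis\<close>

lemma continuous_on_Bernstein [continuous_intros]:
  "continuous_on A f \<Longrightarrow> continuous_on A (\<lambda>x. Bernstein n j (f x))"
  unfolding Bernstein_def by (intro continuous_intros)

lemma continuous_on_bezier [continuous_intros]:
  "continuous_on A f \<Longrightarrow> continuous_on A (\<lambda>x. bezier n r (f x))"
  unfolding bezier_def by (intro continuous_intros)

lemma has_integral_Bernstein:
  assumes "j \<le> n"
  shows "(Bernstein n j has_integral 1 / real (Suc n)) {0..1}"
proof -
  \<comment> \<open>The expansion with coefficients \<open>r\<close> is an antiderivative of \<open>B\<^sup>n\<^sub>j\<close>.\<close>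
  define r where "r i = (if i \<le> j then 0 else 1 / real (Suc n))" for i
  have "poly (pderiv (bezier_poly (Suc n) r)) x = Bernstein n j x" for x
  proof -
    have "poly (pderiv (bezier_poly (Suc n) r)) x =
        real (Suc n) * (\<Sum>i\<le>n. if i = j then Bernstein n i x / real (Suc n) else 0)"
      unfolding pderiv_bezier_poly poly_smult poly_bezier_poly bezier_def
      by (intro arg_cong[where f = "(*) _"] sum.cong) (auto simp: r_def)
    then show ?thesis using assms by (simp del: of_nat_Suc)
  qed
  then have "(bezier (Suc n) r has_vector_derivative Bernstein n j x) (at x within {0..1})" for x
    using poly_DERIV[of "bezier_poly (Suc n) r" x]
    by (auto simp: has_real_derivative_iff_has_vector_derivative intro: has_vector_derivative_at_within)
  then have "(Bernstein n j has_integral bezier (Suc n) r 1 - bezier (Suc n) r 0) {0..1}"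
    by (intro fundamental_theorem_of_calculus) auto
  then show ?thesis using assms by (simp add: r_def)
qed

text \<open>The product is a multiple of the Bernstein polynomial of degree \<open>m + n\<close> and
  index \<open>q + v\<close>, whose integral does not depend on the index. The factors are grouped
  as in \<open>p_hat\<close> and \<open>r_hat\<close>.\<close>

lemma inner01_Bernstein:
  assumes "q \<le> n" "v \<le> m"
  shows "inner01 (Bernstein n q) (Bernstein m v) =
    1 / real (m + n + 1) * real (m choose v) * (inverse (real ((m + n) choose (q + v))) * real (n choose q))"
proof -
  have "Bernstein n q t * Bernstein m v t =
      real (n choose q) * real (m choose v) * inverse (real ((m + n) choose (q + v)))
      * Bernstein (m + n) (q + v) t" for t
  proof -
    have "m + n - (q + v) = (n - q) + (m - v)" using assms by simp
    moreover have "real ((m + n) choose (q + v)) \<noteq> 0" using assms by simp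
    ultimately show ?thesis unfolding Bernstein_def power_add by (simp only: power_add) (simp add: field_simps)
  qed
  then show ?thesis
    using has_integral_Bernstein[of "q + v" "m + n"] assms
    by (simp add: inner01_def integral_unique add_ac)
qed

lemma inner01_commute: "inner01 f g = inner01 g f"
  by (simp add: inner01_def mult.commute)

lemma inner01_diff_left:
  assumes "continuous_on {0..1} f" "continuous_on {0..1} g" "continuous_on {0..1} h"
  shows "inner01 (\<lambda>t. f t - g t) h = inner01 f h - inner01 g h"
proof -
  have "inner01 (\<lambda>t. f t - g t) h = integral {0..1} (\<lambda>t. f t * h t - g t * h t)"
    by (simp add: inner01_def left_diff_distrib)
  also have "\<dots> = inner01 f h - inner01 g h" unfolding inner01_def
    by (intro integral_diff integrable_continuous_interval continuous_intros assms)
  finally show ?thesis .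
qed

lemma inner01_bezier_left:
  assumes "continuous_on {0..1} f"
  shows "inner01 (bezier m r) f = (\<Sum>j\<le>m. r j * inner01 (Bernstein m j) f)"
proof -
  have "inner01 (bezier m r) f = integral {0..1} (\<lambda>t. \<Sum>j\<le>m. r j * (Bernstein m j t * f t))"
    by (simp add: inner01_def bezier_def sum_distrib_right mult.assoc)
  also have "\<dots> = (\<Sum>j\<le>m. integral {0..1} (\<lambda>t. r j * (Bernstein m j t * f t)))"
    by (intro integral_sum integrable_continuous_interval continuous_intros assms) auto
  also have "\<dots> = (\<Sum>j\<le>m. r j * inner01 (Bernstein m j) f)"
    by (simp add: inner01_def)
  finally show ?thesis .
qed

lemma inner01_self_eq_0D:
  assumes "continuous_on {0..1} f" "inner01 f f = 0" "t \<in> {0..1}"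
  shows "f t = 0"
proof -
  have "continuous_on {0..1} (\<lambda>t. f t * f t)" by (intro continuous_intros assms)
  then show ?thesis using integral_eq_0_iff[of 0 1 "\<lambda>t. f t * f t"] assms by (auto simp: inner01_def)
qed

section \<open>Definiteness and solvability of the Gram system\<close>

lemma bezier_restrict:
  assumes "\<And>j. j \<notin> {k..m - l} \<Longrightarrow> r j = 0"
  shows "bezier m r t = (\<Sum>j=k..m - l. r j * Bernstein m j t)"
  unfolding bezier_def by (rule sum.mono_neutral_right) (auto intro!: assms)

lemma inner01_bezier_restrict:
  assumes "\<And>j. j \<notin> {k..m - l} \<Longrightarrow> r j = 0" "continuous_on {0..1} f"
  shows "inner01 (bezier m r) f = (\<Sum>j=k..m - l. r j * inner01 (Bernstein m j) f)"
  unfolding inner01_bezier_left[OF assms(2)]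
  by (rule sum.mono_neutral_right) (auto intro!: assms)

text \<open>The double sum is the squared norm of the combination with coefficients
  \<open>x\<close>; if it is 0, the combination vanishes on [0,1], and by linear independence so do
  its coefficients.\<close>

lemma Gram_pos_def:
  assumes "(\<Sum>i=k..m - l. \<Sum>j=k..m - l. x i * x j * inner01 (Bernstein m i) (Bernstein m j)) = 0"
  shows "\<forall>i\<in>{k..m - l}. x i = 0"
proof
  fix i assume i: "i \<in> {k..m - l}"
  define y where "y j = (if j \<in> {k..m - l} then x j else 0)" for j
  have y0: "y j = 0" if "j \<notin> {k..m - l}" for j using that by (auto simp: y_def)
  have cont: "continuous_on {0..1} (bezier m y)" "\<And>j. continuous_on {0..1} (Bernstein m j)"
    by (intro continuous_intros)+
  have "inner01 (bezier m y) (bezier m y) = (\<Sum>i=k..m - l. y i * inner01 (bezier m y) (Bernstein m i))"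
    by (subst inner01_commute[of _ "Bernstein m i" for i], rule inner01_bezier_restrict) (auto simp: y0 cont)
  also have "\<dots> = (\<Sum>i=k..m - l. y i * (\<Sum>j=k..m - l. y j * inner01 (Bernstein m i) (Bernstein m j)))"
    by (subst inner01_commute[of "Bernstein m i" for i], subst inner01_bezier_restrict[of k m l y])
       (auto simp: y0 cont)
  also have "\<dots> = 0"
    unfolding assms[symmetric] sum_distrib_left by (intro sum.cong) (auto simp: y_def)
  finally have "bezier m y t = 0" if "t \<in> {0..1}" for t
    using inner01_self_eq_0D cont that by blast
  then have "y i = 0" by (rule bezier_zero_imp_coeff_zero) (use i in auto)
  then show "x i = 0" using i by (simp add: y_def)
qed

text \<open>Elimination by bordering: the system on \<open>I\<close> is solved first, then a row and
  a column for \<open>e\<close> are added. The hypothesis passes to subsets by extension with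
  0.\<close>

lemma pos_def_system_solvable:
  fixes G :: "'a \<Rightarrow> 'a \<Rightarrow> real"
  assumes "finite I"
    and "\<And>x. (\<Sum>i\<in>I. \<Sum>j\<in>I. x i * x j * G i j) = 0 \<Longrightarrow> \<forall>i\<in>I. x i = 0"
  shows "\<exists>x. \<forall>i\<in>I. (\<Sum>j\<in>I. x j * G i j) = b i"
  using assms
proof (induction I arbitrary: b)
  case (insert e I)
  have pos: "\<forall>i\<in>I. x i = 0" if "(\<Sum>i\<in>I. \<Sum>j\<in>I. x i * x j * G i j) = 0" for x
  proof -
    define x' where "x' i = (if i = e then 0 else x i)" for i
    have "(\<Sum>j\<in>I. x' i * x' j * G i j) = (\<Sum>j\<in>I. x i * x j * G i j)" if "i \<in> I" for i
      using insert.hyps that by (intro sum.cong) (auto simp: x'_def)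
    then have "(\<Sum>i\<in>insert e I. \<Sum>j\<in>insert e I. x' i * x' j * G i j) = 0"
      using insert.hyps that by (simp add: x'_def[of e])
    from insert.prems[of x', OF this] show ?thesis using insert.hyps by (auto simp: x'_def split: if_splits)
  qed
  have IH: "\<exists>x. \<forall>i\<in>I. (\<Sum>j\<in>I. x j * G i j) = c i" for c
    by (rule insert.IH) (rule pos)
  obtain y where y: "\<And>i. i \<in> I \<Longrightarrow> (\<Sum>j\<in>I. y j * G i j) = G i e" using IH[of "\<lambda>i. G i e"] by blast
  obtain z where z: "\<And>i. i \<in> I \<Longrightarrow> (\<Sum>j\<in>I. z j * G i j) = b i" using IH[of b] by blast
  \<comment> \<open>\<open>S\<close> is minus the Schur complement; positive definiteness at \<open>w\<close> forces \<open>S \<noteq> 0\<close>.\<close>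
  define S where "S = (\<Sum>j\<in>I. y j * G e j) - G e e"
  define w where "w j = (if j = e then - 1 else y j)" for j
  have w: "(\<Sum>j\<in>I. w j * g j) = (\<Sum>j\<in>I. y j * g j)" for g
    using insert.hyps by (intro sum.cong) (auto simp: w_def)
  have wI: "(\<Sum>j\<in>insert e I. w j * G i j) = (if i = e then S else 0)" if "i \<in> insert e I" for i
    using that insert.hyps y by (auto simp: w w_def[of e] S_def)
  have "(\<Sum>i\<in>insert e I. \<Sum>j\<in>insert e I. w i * w j * G i j) =
      (\<Sum>i\<in>insert e I. w i * (\<Sum>j\<in>insert e I. w j * G i j))"
    by (simp only: sum_distrib_left mult.assoc)
  also have "\<dots> = (\<Sum>i\<in>insert e I. if i = e then w e * S else 0)"
    using wI by (intro sum.cong) auto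
  also have "\<dots> = - S" using insert.hyps by (simp add: w_def)
  finally have "S \<noteq> 0" using insert.prems[of w] by (auto simp: w_def)
  \<comment> \<open>Adding \<open>c * w\<close> to the solution \<open>z\<close> leaves the rows in
    \<open>I\<close> intact, because these annihilate \<open>w\<close>; \<open>c\<close> is chosen
    to satisfy row \<open>e\<close>.\<close>
  define c where "c = (b e - (\<Sum>j\<in>I. z j * G e j)) / S"
  define x where "x j = (if j = e then 0 else z j) + c * w j" for j
  have "(\<Sum>j\<in>insert e I. x j * G i j) = b i" if i: "i \<in> insert e I" for i
  proof -
    have "(\<Sum>j\<in>insert e I. x j * G i j) =
      (\<Sum>j\<in>insert e I. (if j = e then 0 else z j) * G i j) + c * (\<Sum>j\<in>insert e I. w j * G i j)"
      by (simp only: x_def distrib_right sum.distrib sum_distrib_left mult.assoc)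
    also have "(\<Sum>j\<in>insert e I. (if j = e then 0 else z j) * G i j) = (\<Sum>j\<in>I. z j * G i j)"
      using insert.hyps by (auto intro!: sum.cong)
    finally show ?thesis
      using wI[OF i] z i insert.hyps \<open>S \<noteq> 0\<close> by (auto simp: c_def)
  qed
  then show ?case by blast
qed simp

text \<open>Pairing the homogeneous equations with \<open>x\<close> itself gives the quadratic form,
  which is definite.\<close>

lemma Gram_injective:
  assumes "\<And>h. h \<in> {k..m - l} \<Longrightarrow> (\<Sum>j=k..m - l. x j * inner01 (Bernstein m j) (Bernstein m h)) = 0"
    and "j \<in> {k..m - l}"
  shows "x j = 0"
proof -
  have "(\<Sum>i=k..m - l. \<Sum>j=k..m - l. x i * x j * inner01 (Bernstein m i) (Bernstein m j)) =
     (\<Sum>i=k..m - l. x i * (\<Sum>j=k..m - l. x j * inner01 (Bernstein m j) (Bernstein m i)))"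
    by (simp add: sum_distrib_left mult.assoc inner01_commute)
  also have "\<dots> = 0" using assms(1) by simp
  finally show ?thesis using Gram_pos_def assms(2) by blast
qed

text \<open>Both definite descriptions are resolved here: solvability of the Gram system gives the
  dual polynomial, injectivity its uniqueness, and linear independence the uniqueness of its
  coefficients.\<close>

lemma dual_coeff_Gram:
  assumes kl: "k + l \<le> m" and i: "i \<in> {k..m - l}" and h: "h \<in> {k..m - l}"
  shows "(\<Sum>j=k..m - l. dual_coeff m k l i j * inner01 (Bernstein m j) (Bernstein m h))
    = (if i = h then 1 else 0)"
proof -
  have cont: "continuous_on {0..1} (Bernstein m j)" for j by (intro continuous_intros)
  have "\<exists>x. \<forall>h\<in>{k..m - l}. (\<Sum>j=k..m - l. x j * inner01 (Bernstein m h) (Bernstein m j))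
      = (if i = h then 1 else 0)"
    by (rule pos_def_system_solvable) (auto dest: Gram_pos_def)
  then obtain x where x: "\<And>h. h \<in> {k..m - l} \<Longrightarrow>
      (\<Sum>j=k..m - l. x j * inner01 (Bernstein m j) (Bernstein m h)) = (if i = h then 1 else 0)"
    by (subst (asm) inner01_commute) blast
  \<comment> \<open>Zero outside the range, to match the default in
    \<open>dual_coeff\<close>.\<close>
  define a where "a j = (if j \<in> {k..m - l} then x j else 0)" for j
  have a0: "a j = 0" if "j \<notin> {k..m - l}" for j using that by (auto simp: a_def)
  have a: "(\<Sum>j=k..m - l. a j * inner01 (Bernstein m j) (Bernstein m h)) = (if i = h then 1 else 0)"
    if "h \<in> {k..m - l}" for h
    unfolding x[OF that, symmetric] by (rule sum.cong) (auto simp: a_def)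
  have inner: "inner01 (bezier m b) (Bernstein m h) = (\<Sum>j=k..m - l. b j * inner01 (Bernstein m j) (Bernstein m h))"
    if "\<And>j. j \<notin> {k..m - l} \<Longrightarrow> b j = 0" for b h
    by (rule inner01_bezier_restrict[OF that cont])
  have poly_bez: "poly (bezier_poly m r) = bezier m r" for r by (simp add: fun_eq_iff)
  have dual: "dual_bernstein m k l i = bezier_poly m a"
    unfolding dual_bernstein_def
  proof (rule the_equality, safe)
    show "bezier_poly m a \<in> constrained_polys m k l"
      unfolding constrained_polys_iff[OF kl] using a0 by blast
    show "inner01 (poly (bezier_poly m a)) (Bernstein m j) = (if i = j then 1 else 0)"
      if "j \<in> {k..m - l}" for j
      using a[OF that] inner[of a j] a0 by (simp only: poly_bez) blast
  next
    fix Q assume "Q \<in> constrained_polys m k l"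
    then obtain b where Q: "Q = bezier_poly m b" and b0: "\<And>j. j \<notin> {k..m - l} \<Longrightarrow> b j = 0"
      unfolding constrained_polys_iff[OF kl] by blast
    assume "\<forall>j\<in>{k..m - l}. inner01 (poly Q) (Bernstein m j) = (if i = j then 1 else 0)"
    then have "(\<Sum>j=k..m - l. (b j - a j) * inner01 (Bernstein m j) (Bernstein m h)) = 0"
      if "h \<in> {k..m - l}" for h
      using a[OF that] that inner[of b h, OF b0]
      by (auto simp: Q poly_bez left_diff_distrib sum_subtractf)
    then have "b j - a j = 0" if "j \<in> {k..m - l}" for j
      using that by (rule Gram_injective)
    then have "b j = a j" for j using a0[of j] b0[of j] by (cases "j \<in> {k..m - l}") auto
    then have "b = a" ..
    then show "Q = bezier_poly m a" by (simp add: Q)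
  qed
  have "dual_coeff m k l i = a"
    unfolding dual_coeff_def dual
  proof (rule the_equality, safe)
    show "poly (bezier_poly m a) t = (\<Sum>j=k..m - l. a j * Bernstein m j t)" for t
      using bezier_restrict[of k m l a t] a0 by simp
  next
    fix b assume b0: "\<forall>j. j \<notin> {k..m - l} \<longrightarrow> b j = 0"
      and b: "\<forall>t. poly (bezier_poly m a) t = (\<Sum>j=k..m - l. b j * Bernstein m j t)"
    have "bezier m b t = bezier m a t" for t using b b0 bezier_restrict[of k m l b t] by simp
    then have "bezier m (\<lambda>j. b j - a j) t = 0" for t
      by (simp add: bezier_def left_diff_distrib sum_subtractf)
    then have "b j - a j = 0" if "j \<le> m" for j
      using bezier_zero_imp_coeff_zero[of m "\<lambda>j. b j - a j" j] that by blast
    \<comment> \<open>Beyond \<open>m\<close> the polynomial carries no information; the default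
      value 0 decides.\<close>
    moreover have "b j = a j" if "j > m" for j
    proof -
      have "j \<notin> {k..m - l}" using that by auto
      then show ?thesis using a0[of j] b0 by simp
    qed
    ultimately have "b j = a j" for j by (cases "j \<le> m") auto
    then show "b = a" ..
  qed (simp add: a0)
  then show ?thesis using a[OF h] by simp
qed

text \<open>Multiplication by the inverse Gram matrix. As \<open>b\<close> is arbitrary for each
  \<open>r\<close>, it may itself be computed from \<open>r\<close>; \<open>r_hat\<close> is used in
  this way.\<close>

lemma dual_coeff_solves:
  assumes kl: "k + l \<le> m"
  shows "(\<forall>h\<in>{k..m - l}. (\<Sum>j=k..m - l. r j * inner01 (Bernstein m j) (Bernstein m h)) = b h)
    \<longleftrightarrow> (\<forall>j\<in>{k..m - l}. r j = (\<Sum>h=k..m - l. b h * dual_coeff m k l h j))"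
proof -
  let ?c = "\<lambda>j. \<Sum>h=k..m - l. b h * dual_coeff m k l h j"
  have c: "(\<Sum>j=k..m - l. ?c j * inner01 (Bernstein m j) (Bernstein m h)) = b h"
    if h: "h \<in> {k..m - l}" for h
  proof -
    have "(\<Sum>j=k..m - l. ?c j * inner01 (Bernstein m j) (Bernstein m h)) =
      (\<Sum>i=k..m - l. b i * (\<Sum>j=k..m - l. dual_coeff m k l i j * inner01 (Bernstein m j) (Bernstein m h)))"
      unfolding sum_distrib_left sum_distrib_right by (subst sum.swap) (simp add: mult.assoc)
    also have "\<dots> = (\<Sum>i=k..m - l. if i = h then b h else 0)"
      by (rule sum.cong) (simp_all add: dual_coeff_Gram[OF kl _ h] del: atLeastAtMost_iff)
    also have "\<dots> = b h" using h by simp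
    finally show ?thesis .
  qed
  show ?thesis
  proof (intro iffI ballI)
    fix j assume "\<forall>h\<in>{k..m - l}. (\<Sum>j=k..m - l. r j * inner01 (Bernstein m j) (Bernstein m h)) = b h"
      and j: "j \<in> {k..m - l}"
    then have "(\<Sum>j=k..m - l. (r j - ?c j) * inner01 (Bernstein m j) (Bernstein m h)) = 0"
      if "h \<in> {k..m - l}" for h
      using c[OF that] that by (simp add: left_diff_distrib sum_subtractf)
    then have "r j - ?c j = 0" using j by (rule Gram_injective)
    then show "r j = ?c j" by simp
  next
    fix h assume r: "\<forall>j\<in>{k..m - l}. r j = ?c j" and h: "h \<in> {k..m - l}"
    show "(\<Sum>j=k..m - l. r j * inner01 (Bernstein m j) (Bernstein m h)) = b h"
      unfolding c[OF h, symmetric] using r by (intro sum.cong) auto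
  qed
qed

subsection \<open>Integrals over the segments\<close>

text \<open>A generating function of the Bernstein polynomials in their lower index, by the binomial
  theorem.\<close>

lemma coeff_linear_power_Bernstein: "coeff ([:1 - y, y:] ^ m) h = Bernstein m h y"
proof (cases "h \<le> m")
  case False
  have "degree ([:1 - y, y:] ^ m) \<le> degree [:1 - y, y:] * m" by (rule degree_power_le)
  also have "\<dots> \<le> m" by simp
  finally show ?thesis using False by (simp add: coeff_eq_0 Bernstein_eq_0)
qed (simp add: coeff_linear_poly_power Bernstein_def)

lemma Bernstein_affine:
  "Bernstein m h ((1 - u) * t (i - 1) + u * t i) = (\<Sum>v\<le>m. d_coeff m t i h v * Bernstein m v u)"
proof -
  define a where "a = t (i - 1)"
  let ?a = a and ?b = "t i"
  \<comment> \<open>\<open>B\<^sup>m\<^sub>h(y)\<close> is the coefficient of \<open>x\<^sup>h\<close> in \<open>(1 - y + y x)\<^sup>m\<close>, whose base is affine in \<open>y\<close>.\<close>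
  have lin: "[:1 - ((1 - u) * ?a + u * ?b), (1 - u) * ?a + u * ?b:] =
      smult u [:1 - ?b, ?b:] + smult (1 - u) [:1 - ?a, ?a:]"
    by (simp add: algebra_simps)
  \<comment> \<open>The Cauchy product yields the convolution in \<open>d_coeff\<close>; the ranges
    up to \<open>h\<close> and up to \<open>v\<close> differ only by zero terms.\<close>
  have d: "coeff ([:1 - ?b, ?b:] ^ v * [:1 - ?a, ?a:] ^ (m - v)) h = d_coeff m t i h v" for v
  proof -
    let ?f = "\<lambda>w. (if w \<le> h then Bernstein (m - v) (h - w) ?a else 0) * Bernstein v w ?b"
    have "coeff ([:1 - ?b, ?b:] ^ v * [:1 - ?a, ?a:] ^ (m - v)) h = (\<Sum>w\<le>h. ?f w)"
      unfolding coeff_mult coeff_linear_power_Bernstein by (rule sum.cong) auto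
    also have "\<dots> = (\<Sum>w\<le>max h v. ?f w)"
      by (rule sum.mono_neutral_left) auto
    also have "\<dots> = (\<Sum>w\<le>v. ?f w)"
      by (rule sum.mono_neutral_right) (auto simp: Bernstein_eq_0)
    finally show ?thesis unfolding d_coeff_def a_def .
  qed
  have "Bernstein m h ((1 - u) * ?a + u * ?b) =
      coeff ((smult u [:1 - ?b, ?b:] + smult (1 - u) [:1 - ?a, ?a:]) ^ m) h"
    unfolding coeff_linear_power_Bernstein[symmetric] lin ..
  also have "\<dots> = (\<Sum>v\<le>m. real (m choose v) * u ^ v * (1 - u) ^ (m - v) *
      coeff ([:1 - ?b, ?b:] ^ v * [:1 - ?a, ?a:] ^ (m - v)) h)"
    unfolding binomial_ring
    by (simp add: coeff_sum smult_power of_nat_poly mult_ac del: smult_pCons)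
  also have "\<dots> = (\<Sum>v\<le>m. d_coeff m t i h v * Bernstein m v u)"
    unfolding d by (simp add: Bernstein_def mult_ac)
  finally show ?thesis by (simp add: a_def)
qed

lemma inner01_bezier_Bernstein:
  assumes "v \<le> m"
  shows "inner01 (bezier (n i) (p i)) (Bernstein m v) = p_hat m n p i v"
proof -
  have "inner01 (bezier (n i) (p i)) (Bernstein m v) =
      (\<Sum>q\<le>n i. p i q * inner01 (Bernstein (n i) q) (Bernstein m v))"
    by (intro inner01_bezier_left continuous_intros)
  also have "\<dots> = p_hat m n p i v"
    unfolding p_hat_def sum_distrib_left
    by (rule sum.cong) (simp_all add: inner01_Bernstein assms algebra_simps)
  finally show ?thesis .
qed

lemma has_integral_rescale_unit:
  fixes f :: "real \<Rightarrow> real"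
  assumes "a < b" "(f has_integral I) {0..1}"
  shows "((\<lambda>x. f ((x - a) / (b - a))) has_integral (b - a) * I) {a..b}"
proof -
  define c where "c = b - a"
  have c: "c > 0" "b = a + c" using assms(1) by (auto simp: c_def)
  have "((\<lambda>x. f ((1 / c) *\<^sub>R x + - a / c)) has_integral I /\<^sub>R (1 / c) ^ DIM(real))
      (cbox ((0 - - a / c) /\<^sub>R (1 / c)) ((1 - - a / c) /\<^sub>R (1 / c)))"
    using assms(2) c by (intro has_integral_affinity') auto
  moreover have "(1 / c) *\<^sub>R x + - a / c = (x - a) / c" for x by (simp add: diff_divide_distrib)
  moreover have "(0 - - a / c) /\<^sub>R (1 / c) = a" "(1 - - a / c) /\<^sub>R (1 / c) = b" "I /\<^sub>R (1 / c) ^ DIM(real) = c * I"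
    using c by (simp_all add: field_simps)
  ultimately show ?thesis unfolding c_def[symmetric] by simp
qed

text \<open>Substitution of the local parameter, with the segment length as Jacobian.
  \<open>Bernstein_affine\<close> expands the other factor in that parameter, and termwise
  integration leaves \<open>p_hat\<close>.\<close>

lemma integral_segment:
  assumes "t (i - 1) < t i"
  shows "integral {t (i - 1)..t i} (\<lambda>x. bezier (n i) (p i) ((x - t (i - 1)) / (t i - t (i - 1))) * Bernstein m h x)
    = (t i - t (i - 1)) * (\<Sum>v\<le>m. p_hat m n p i v * d_coeff m t i h v)"
proof -
  let ?a = "t (i - 1)" and ?b = "t i" and ?q = "bezier (n i) (p i)"
  let ?f = "\<lambda>u. ?q u * Bernstein m h ((1 - u) * ?a + u * ?b)"
  have ab: "?b - ?a > 0" using assms by simp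
  have f: "?f = (\<lambda>u. \<Sum>v\<le>m. d_coeff m t i h v * (?q u * Bernstein m v u))"
    unfolding Bernstein_affine sum_distrib_left by (simp add: mult.left_commute)
  have "integral {0..1} ?f = (\<Sum>v\<le>m. integral {0..1} (\<lambda>u. d_coeff m t i h v * (?q u * Bernstein m v u)))"
    unfolding f by (intro integral_sum integrable_continuous_interval continuous_intros) auto
  also have "\<dots> = (\<Sum>v\<le>m. p_hat m n p i v * d_coeff m t i h v)"
    by (rule sum.cong) (auto simp: inner01_bezier_Bernstein[symmetric] inner01_def)
  finally have I: "integral {0..1} ?f = (\<Sum>v\<le>m. p_hat m n p i v * d_coeff m t i h v)" .
  have "?f integrable_on {0..1}" by (intro integrable_continuous_interval continuous_intros)
  then have "((\<lambda>x. ?f ((x - ?a) / (?b - ?a))) has_integral (?b - ?a) * integral {0..1} ?f) {?a..?b}"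
    by (intro has_integral_rescale_unit assms integrable_integral)
  moreover have "(1 - (x - ?a) / (?b - ?a)) * ?a + (x - ?a) / (?b - ?a) * ?b = x" for x
    using ab by (simp add: divide_simps) (simp add: algebra_simps)
  ultimately show ?thesis unfolding I by (simp only: integral_unique)
qed

text \<open>Continuity on the whole interval belongs to the same induction, since combining the
  integrals over adjacent intervals needs integrability on their union.\<close>

lemma integral_partition:
  fixes t :: "nat \<Rightarrow> real" and f :: "real \<Rightarrow> real"
  assumes "\<And>i. i < s \<Longrightarrow> t i < t (Suc i)"
    and "\<And>i. i \<in> {1..s} \<Longrightarrow> continuous_on {t (i - 1)..t i} f"
  shows "t 0 \<le> t s \<and> continuous_on {t 0..t s} f \<and>
    integral {t 0..t s} f = (\<Sum>i=1..s. integral {t (i - 1)..t i} f)"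
  using assms
proof (induction s)
  case (Suc s)
  then have IH: "t 0 \<le> t s" "continuous_on {t 0..t s} f"
    "integral {t 0..t s} f = (\<Sum>i=1..s. integral {t (i - 1)..t i} f)" by auto
  have st: "t s < t (Suc s)" "continuous_on {t s..t (Suc s)} f"
    using Suc.prems(1)[of s] Suc.prems(2)[of "Suc s"] by auto
  have "{t 0..t (Suc s)} = {t 0..t s} \<union> {t s..t (Suc s)}" using IH(1) st(1) by auto
  then have cont: "continuous_on {t 0..t (Suc s)} f"
    using continuous_on_closed_Un[OF _ _ IH(2) st(2)] by simp
  have "integral {t 0..t s} f + integral {t s..t (Suc s)} f = integral {t 0..t (Suc s)} f"
    using IH(1) st(1) cont by (intro Henstock_Kurzweil_Integration.integral_combine integrable_continuous_interval) auto
  then show ?case using IH st cont by simp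
qed simp

subsection \<open>Feasibility and optimality\<close>

text \<open>Differentiation within [0,1] looks only at nearby points, so agreement on a relatively
  open set passes from each derivative to the next. The set \<open>U\<close> lets a piecewise
  function be treated near one end point.\<close>

lemma nderiv01_eq_poly:
  assumes "open U" and f: "\<And>x. x \<in> U \<inter> {0..1} \<Longrightarrow> f x = poly Q x"
  shows "x \<in> U \<inter> {0..1} \<Longrightarrow> nderiv01 i f x = poly ((pderiv ^^ i) Q) x"
proof (induction i arbitrary: x)
  case 0
  then show ?case by (simp add: nderiv01_def f)
next
  case (Suc i)
  let ?g = "nderiv01 i f" and ?Q = "(pderiv ^^ i) Q"
  obtain d where d: "d > 0" "ball x d \<subseteq> U" using assms(1) Suc.prems openE by blast
  have "(poly ?Q has_vector_derivative poly (pderiv ?Q) x) (at x within {0..1})"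
    using poly_DERIV[of ?Q x]
    by (simp add: has_real_derivative_iff_has_vector_derivative has_vector_derivative_at_within)
  then have "(?g has_vector_derivative poly (pderiv ?Q) x) (at x within {0..1})"
  proof (rule has_vector_derivative_transform_within)
    show "poly ?Q y = ?g y" if "y \<in> {0..1}" "dist y x < d" for y
      using Suc.IH[of y] that d(2) by (auto simp: dist_commute)
  qed (use d Suc.prems in auto)
  then have "vector_derivative ?g (at x within {0..1}) = poly (pderiv ?Q) x"
    using Suc.prems by (intro vector_derivative_within_closed_interval) auto
  then show ?case by (simp add: nderiv01_def)
qed

lemma nderiv01_bezier:
  assumes "x \<in> {0..1}"
  shows "nderiv01 i (bezier m r) x = poly ((pderiv ^^ i) (bezier_poly m r)) x"
  by (rule nderiv01_eq_poly[of UNIV]) (use assms in auto)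

lemma feasible_iff_fdiff:
  assumes "k \<le> m" "l \<le> m"
  shows "feasible m k l P r \<longleftrightarrow>
    (\<forall>i<k. fact m / fact (m - i) * fdiff i r 0 = nderiv01 i P 0) \<and>
    (\<forall>i<l. fact m / fact (m - i) * fdiff i r (m - i) = nderiv01 i P 1)"
  using assms by (simp add: feasible_def nderiv01_bezier higher_pderiv_bezier_0 higher_pderiv_bezier_1)

section \<open>Feasible sequences and the first variation of the error\<close>

lemma fdiff_diff: "fdiff i (\<lambda>j. c j - d j) h = fdiff i c h - fdiff i d h"
  by (induction i arbitrary: h) auto

text \<open>Differences are linear, so two feasible sequences differ by a solution of the
  homogeneous triangular systems. From one feasible sequence all others arise by varying the
  remaining coefficients.\<close>

lemma feasible_iff_agree:
  assumes kl: "k \<le> m" "l \<le> m" and r: "feasible m k l P r"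
  shows "feasible m k l P r' \<longleftrightarrow> (\<forall>j<k. r' j = r j) \<and> (\<forall>j<l. r' (m - j) = r (m - j))"
proof
  let ?d = "\<lambda>j. r' j - r j"
  assume "feasible m k l P r'"
  with r have "fact m / fact (m - i) * fdiff i r' 0 = fact m / fact (m - i) * fdiff i r 0" if "i < k" for i
    using that unfolding feasible_iff_fdiff[OF kl] by metis
  then have "fdiff i ?d 0 = 0" if "i < k" for i using that by (simp add: fdiff_diff)
  then have "?d j = 0" if "j < k" for j using fdiff_left_0D[of k ?d j] that by blast
  moreover from r \<open>feasible m k l P r'\<close>
  have "fact m / fact (m - i) * fdiff i r' (m - i) = fact m / fact (m - i) * fdiff i r (m - i)" if "i < l" for i
    using that unfolding feasible_iff_fdiff[OF kl] by metis
  then have "fdiff i ?d (m - i) = 0" if "i < l" for i using that by (simp add: fdiff_diff)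
  then have "?d (m - j) = 0" if "j < l" for j
    using fdiff_right_0D[of l ?d m j] that kl by auto
  ultimately show "(\<forall>j<k. r' j = r j) \<and> (\<forall>j<l. r' (m - j) = r (m - j))" by simp
next
  assume *: "(\<forall>j<k. r' j = r j) \<and> (\<forall>j<l. r' (m - j) = r (m - j))"
  have "fdiff i r' 0 = fdiff i r 0" if "i < k" for i
    unfolding fdiff_eq_sum by (rule sum.cong) (use that * in auto)
  moreover have "fdiff i r' (m - i) = fdiff i r (m - i)" if "i < l" for i
    unfolding fdiff_eq_sum
  proof (rule sum.cong)
    fix j assume "j \<in> {..i}"
    then have "m - i + j = m - (i - j)" "i - j < l" using that kl by auto
    then show "(- 1) ^ (i + j) * real (i choose j) * r' (m - i + j) =
        (- 1) ^ (i + j) * real (i choose j) * r (m - i + j)" using * by metis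
  qed simp
  ultimately show "feasible m k l P r'" using r by (simp add: feasible_iff_fdiff[OF kl])
qed

text \<open>Both directions of the optimality criterion rest on this expansion: \<open>e\<close>
  varies in one, and \<open>e = 1\<close> in the other.\<close>

lemma sq_error_add:
  assumes "continuous_on {0..1} P"
  shows "sq_error m P (\<lambda>j. r j + e * d j) =
    sq_error m P r + 2 * e * inner01 (bezier m d) (\<lambda>t. bezier m r t - P t)
    + e\<^sup>2 * inner01 (bezier m d) (bezier m d)"
proof -
  have "bezier m (\<lambda>j. r j + e * d j) t = bezier m r t + e * bezier m d t" for t
    by (simp add: bezier_def distrib_right sum.distrib sum_distrib_left mult.assoc)
  then have "sq_error m P (\<lambda>j. r j + e * d j) = integral {0..1} (\<lambda>t.
      (bezier m r t - P t) * (bezier m r t - P t) + 2 * e * (bezier m d t * (bezier m r t - P t))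
      + e\<^sup>2 * (bezier m d t * bezier m d t))"
    unfolding sq_error_def inner01_def
    by (intro arg_cong[where f = "integral {0..1}"]) (simp add: fun_eq_iff algebra_simps power2_eq_square)
  also have "\<dots> = integral {0..1} (\<lambda>t. (bezier m r t - P t) * (bezier m r t - P t) + 2 * e * (bezier m d t * (bezier m r t - P t)))
     + integral {0..1} (\<lambda>t. e\<^sup>2 * (bezier m d t * bezier m d t))"
    by (intro integral_add integrable_continuous_interval continuous_intros assms)
  also have "integral {0..1} (\<lambda>t. (bezier m r t - P t) * (bezier m r t - P t) + 2 * e * (bezier m d t * (bezier m r t - P t)))
     = integral {0..1} (\<lambda>t. (bezier m r t - P t) * (bezier m r t - P t)) +
       integral {0..1} (\<lambda>t. 2 * e * (bezier m d t * (bezier m r t - P t)))"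
    by (intro integral_add integrable_continuous_interval continuous_intros assms)
  finally show ?thesis by (simp add: sq_error_def inner01_def)
qed

lemma linear_term_zero:
  fixes a b :: real
  assumes "\<And>e. 0 \<le> 2 * e * a + e\<^sup>2 * b"
  shows "a = 0"
proof (rule ccontr)
  assume "a \<noteq> 0"
  \<comment> \<open>Chosen so that \<open>e = - a / c\<close> gives the negative value
    \<open>a^2 / c^2 * (b - 2 * c)\<close>; the summand 1 keeps \<open>c\<close> positive for
    \<open>b = 0\<close>.\<close>
  define c where "c = \<bar>b\<bar> + 1"
  have c: "c > 0" "b < 2 * c" by (auto simp: c_def)
  have "0 \<le> 2 * (- a / c) * a + (- a / c)\<^sup>2 * b" by (rule assms)
  also have "\<dots> = a\<^sup>2 / c\<^sup>2 * (b - 2 * c)"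
    using c(1) by (simp add: field_simps power2_eq_square)
  also have "\<dots> < 0"
    using \<open>a \<noteq> 0\<close> c by (intro mult_pos_neg) auto
  finally show False by simp
qed

text \<open>Necessity by varying each free coefficient, sufficiency by Pythagoras.\<close>

lemma optimal_iff_orthogonal:
  assumes cont: "continuous_on {0..1} P" and kl: "k + l \<le> m"
  shows "optimal m k l P r \<longleftrightarrow> feasible m k l P r \<and>
    (\<forall>h\<in>{k..m - l}. inner01 (Bernstein m h) (\<lambda>t. bezier m r t - P t) = 0)"
proof
  have contR: "continuous_on {0..1} (\<lambda>t. bezier m r t - P t)" by (intro continuous_intros cont)
  have kl': "k \<le> m" "l \<le> m" using kl by auto
  {
    assume opt: "optimal m k l P r"
    then have feas: "feasible m k l P r" by (simp add: optimal_def)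
    have "inner01 (Bernstein m h) (\<lambda>t. bezier m r t - P t) = 0" if h: "h \<in> {k..m - l}" for h
    proof -
      define d :: "nat \<Rightarrow> real" where "d j = (if j = h then 1 else 0)" for j
      have "bezier m d = Bernstein m h"
      proof
        fix t show "bezier m d t = Bernstein m h t"
          unfolding bezier_def d_def using h by (simp add: if_distrib[where f = "\<lambda>x. x * _"] Bernstein_eq_0 cong: if_cong)
      qed
      have "0 \<le> 2 * e * inner01 (Bernstein m h) (\<lambda>t. bezier m r t - P t)
          + e\<^sup>2 * inner01 (Bernstein m h) (Bernstein m h)" for e
      proof -
        have "feasible m k l P (\<lambda>j. r j + e * d j)"
          unfolding feasible_iff_agree[OF kl' feas] using h kl by (auto simp: d_def)
        then have "sq_error m P r \<le> sq_error m P (\<lambda>j. r j + e * d j)"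
          using opt by (simp add: optimal_def)
        then show ?thesis unfolding sq_error_add[OF cont] \<open>bezier m d = Bernstein m h\<close> by simp
      qed
      then show ?thesis by (rule linear_term_zero)
    qed
    with feas show "feasible m k l P r \<and>
      (\<forall>h\<in>{k..m - l}. inner01 (Bernstein m h) (\<lambda>t. bezier m r t - P t) = 0)" by blast
  }
  {
    assume *: "feasible m k l P r \<and>
      (\<forall>h\<in>{k..m - l}. inner01 (Bernstein m h) (\<lambda>t. bezier m r t - P t) = 0)"
    have "sq_error m P r \<le> sq_error m P r'" if "feasible m k l P r'" for r'
    proof -
      let ?d = "\<lambda>j. r' j - r j"
      have agree: "(\<forall>j<k. r' j = r j) \<and> (\<forall>j<l. r' (m - j) = r (m - j))"
        using feasible_iff_agree[OF kl' conjunct1[OF *]] that by blast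
      have d0: "?d j = 0" if "j \<le> m" "j \<notin> {k..m - l}" for j
        using agree[THEN conjunct1, rule_format, of j] agree[THEN conjunct2, rule_format, of "m - j"] that kl
        by auto
      have "inner01 (bezier m ?d) (\<lambda>t. bezier m r t - P t) =
          (\<Sum>j\<le>m. ?d j * inner01 (Bernstein m j) (\<lambda>t. bezier m r t - P t))"
        by (rule inner01_bezier_left[OF contR])
      \<comment> \<open>Outer summands vanish since feasible sequences agree there, inner ones by
        orthogonality.\<close>
      also have "\<dots> = 0"
      proof (rule sum.neutral, rule ballI)
        fix j assume "j \<in> {..m}"
        then show "?d j * inner01 (Bernstein m j) (\<lambda>t. bezier m r t - P t) = 0"
          using d0[of j] * by (cases "j \<in> {k..m - l}") auto
      qed
      finally have "sq_error m P r' = sq_error m P r + inner01 (bezier m ?d) (bezier m ?d)"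
        using sq_error_add[OF cont, of m r 1 ?d] by simp
      moreover have "0 \<le> inner01 (bezier m ?d) (bezier m ?d)"
        unfolding inner01_def
        by (intro integral_nonneg integrable_continuous_interval continuous_intros) auto
      ultimately show ?thesis by simp
    qed
    with * show "optimal m k l P r" by (simp add: optimal_def)
  }
qed

subsection \<open>Boundary coefficients\<close>

lemma higher_pderiv_pcompose_linear:
  fixes f :: "real poly"
  shows "(pderiv ^^ j) (pcompose f [:c, d:]) = smult (d ^ j) (pcompose ((pderiv ^^ j) f) [:c, d:])"
  by (induction j) (simp_all add: pderiv_smult pderiv_pcompose pderiv_pCons mult.commute)

text \<open>On the part of [0,1] cut out by \<open>U\<close> only one segment is seen, so
  \<open>f\<close> is there a polynomial composed with a linear map; each derivative contributes a
  factor \<open>1 / (b - a)\<close>.\<close>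

lemma nderiv01_segment:
  assumes "open U" "U \<inter> {0..1} \<subseteq> {a..b}" "x \<in> U \<inter> {0..1}"
    and f: "\<And>x. x \<in> {a..b} \<Longrightarrow> f x = bezier n q ((x - a) / (b - a))"
  shows "nderiv01 j f x = inverse ((b - a) ^ j) * poly ((pderiv ^^ j) (bezier_poly n q)) ((x - a) / (b - a))"
proof -
  let ?L = "[:- a / (b - a), inverse (b - a):]"
  have L: "poly ?L x = (x - a) / (b - a)" for x by (simp add: divide_inverse left_diff_distrib)
  have "nderiv01 j f x = poly ((pderiv ^^ j) (pcompose (bezier_poly n q) ?L)) x"
  proof (rule nderiv01_eq_poly[OF assms(1) _ assms(3)])
    show "f y = poly (pcompose (bezier_poly n q) ?L) y" if "y \<in> U \<inter> {0..1}" for y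
      using f[of y] that assms(2) unfolding poly_pcompose L by auto
  qed
  then show ?thesis
    unfolding higher_pderiv_pcompose_linear poly_smult poly_pcompose L by (simp add: power_inverse)
qed

text \<open>The quotient of the falling factorials of \<open>n\<close> and \<open>m\<close> equals
  that of the binomial coefficients, since \<open>fact j\<close> cancels.\<close>

lemma fact_ratio_eq_iff:
  fixes F g d :: real
  assumes "j \<le> m" "j \<le> n" "d \<noteq> 0"
  shows "fact m / fact (m - j) * F = inverse (d ^ j) * (fact n / fact (n - j) * g) \<longleftrightarrow>
    F = real (n choose j) * inverse (real (m choose j)) * inverse (d ^ j) * g"
  using assms by (simp add: binomial_fact field_simps)

text \<open>The subtractions of 0 reproduce the shape of the segment formula after
  \<open>t 0\<close> has been replaced by 0.\<close>

lemma nderiv01_left_end: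
  assumes "0 < b" "b \<le> 1" "j \<le> n"
    and f: "\<And>x. x \<in> {0..b} \<Longrightarrow> f x = bezier n q ((x - 0) / (b - 0))"
  shows "nderiv01 j f 0 = inverse ((b - 0) ^ j) * (fact n / fact (n - j) * fdiff j q 0)"
proof -
  have "nderiv01 j f 0 = inverse ((b - 0) ^ j) * poly ((pderiv ^^ j) (bezier_poly n q)) ((0 - 0) / (b - 0))"
    by (rule nderiv01_segment[of "{..<b}" 0 b 0 f n q j, OF _ _ _ f]) (use assms(1,2) in auto)
  then show ?thesis using assms(3) by (simp add: higher_pderiv_bezier_0)
qed

lemma nderiv01_right_end:
  assumes "0 \<le> a" "a < 1" "j \<le> n"
    and f: "\<And>x. x \<in> {a..1} \<Longrightarrow> f x = bezier n q ((x - a) / (1 - a))"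
  shows "nderiv01 j f 1 = inverse ((1 - a) ^ j) * (fact n / fact (n - j) * fdiff j q (n - j))"
proof -
  have "nderiv01 j f 1 = inverse ((1 - a) ^ j) * poly ((pderiv ^^ j) (bezier_poly n q)) ((1 - a) / (1 - a))"
    by (rule nderiv01_segment[of "{a<..}" a 1 1 f n q j, OF _ _ _ f]) (use assms(1,2) in auto)
  then show ?thesis using assms(2,3) by (simp add: higher_pderiv_bezier_1)
qed

text \<open>The bounds on \<open>k\<close> ensure \<open>j \<le> n 1\<close> and
  \<open>j \<le> m\<close>, so the derivative formulas apply; the recursion for \<open>r j\<close>
  is the \<open>j\<close>-th condition solved for its newest unknown.\<close>

lemma left_coeffs_iff_nderiv01:
  assumes t: "t 0 = 0" "0 < t 1" "t 1 \<le> 1"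
    and P: "\<And>x. x \<in> {t 0..t 1} \<Longrightarrow> P x = bezier (n 1) (p 1) ((x - t 0) / (t 1 - t 0))"
    and k: "k \<le> n 1 + 1" "k \<le> m"
  shows "left_coeffs m k t n p r \<longleftrightarrow> (\<forall>j<k. fact m / fact (m - j) * fdiff j r 0 = nderiv01 j P 0)"
  unfolding left_coeffs_def
proof (intro all_cong)
  fix j assume "j < k"
  then have j: "j \<le> m" "j \<le> n 1" using k by auto
  have nz: "t 1 - t 0 \<noteq> 0" using t by simp
  have "nderiv01 j P 0 = inverse ((t 1 - t 0) ^ j) * (fact (n 1) / fact (n 1 - j) * fdiff j (p 1) 0)"
    unfolding t(1) by (rule nderiv01_left_end[where f = P, OF t(2,3) j(2) P[unfolded t(1)]])
  then show "(r j = real (n 1 choose j) * inverse (real (m choose j)) * inverse ((t 1 - t 0) ^ j) * fdiff j (p 1) 0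
      - (\<Sum>h<j. (-1) ^ (j + h) * real (j choose h) * r h)) \<longleftrightarrow>
    fact m / fact (m - j) * fdiff j r 0 = nderiv01 j P 0"
    unfolding eq_diff_eq fdiff_left[of j r, symmetric] fact_ratio_eq_iff[OF j nz, symmetric] by (simp only:)
qed

lemma right_coeffs_iff_nderiv01:
  assumes t: "t s = 1" "0 \<le> t (s - 1)" "t (s - 1) < 1"
    and P: "\<And>x. x \<in> {t (s - 1)..t s} \<Longrightarrow>
      P x = bezier (n s) (p s) ((x - t (s - 1)) / (t s - t (s - 1)))"
    and l: "l \<le> n s + 1" "l \<le> m"
  shows "right_coeffs m l s t n p r \<longleftrightarrow>
    (\<forall>j<l. fact m / fact (m - j) * fdiff j r (m - j) = nderiv01 j P 1)"
  unfolding right_coeffs_def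
proof (intro all_cong)
  fix j assume "j < l"
  then have j: "j \<le> m" "j \<le> n s" using l by auto
  have nz: "t s - t (s - 1) \<noteq> 0" using t by simp
  have nderiv: "nderiv01 j P 1 =
      inverse ((t s - t (s - 1)) ^ j) * (fact (n s) / fact (n s - j) * fdiff j (p s) (n s - j))"
    unfolding t(1) by (rule nderiv01_right_end[where f = P, OF t(2,3) j(2) P[unfolded t(1)]])
  \<comment> \<open>\<open>(-1) ^ j\<close> is its own inverse, which moves the sign of the
    recursion into the difference.\<close>
  have sign: "x = (-1) ^ j * y \<longleftrightarrow> (-1) ^ j * x = y" for x y :: real
    by (cases "even j") auto
  show "(r (m - j) = (-1) ^ j * real (n s choose j) * inverse (real (m choose j))
        * inverse ((t s - t (s - 1)) ^ j) * fdiff j (p s) (n s - j)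
      - (\<Sum>h=1..j. (-1) ^ h * real (j choose h) * r (m - j + h))) \<longleftrightarrow>
    fact m / fact (m - j) * fdiff j r (m - j) = nderiv01 j P 1"
    unfolding nderiv fact_ratio_eq_iff[OF j nz] fdiff_right[OF j(1)] eq_diff_eq mult.assoc sign ..
qed

section \<open>Solvability of the boundary recursions and the normal equations\<close>

lemma triangular_system_solvable:
  fixes g :: "nat \<Rightarrow> real"
  shows "\<exists>r. \<forall>j<k. r j = g j - (\<Sum>h<j. c j h * r h)"
proof (induction k)
  case (Suc k)
  then obtain r where r: "\<forall>j<k. r j = g j - (\<Sum>h<j. c j h * r h)" by blast
  \<comment> \<open>Rows before \<open>k\<close> do not involve entry \<open>k\<close>, so it can be
    set to satisfy row \<open>k\<close>.\<close>
  let ?r = "r(k := g k - (\<Sum>h<k. c k h * r h))"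
  have "(\<Sum>h<j. c j h * ?r h) = (\<Sum>h<j. c j h * r h)" if "j \<le> k" for j
    by (rule sum.cong) (use that in auto)
  moreover have "?r j = g j - (\<Sum>h<j. c j h * r h)" if "j < Suc k" for j
  proof (cases "j = k")
    case False
    with that have "j < k" by simp
    with r show ?thesis unfolding fun_upd_other[OF False] by blast
  qed simp
  ultimately show ?case by (intro exI[of _ ?r]) (auto simp del: fun_upd_apply)
qed simp

text \<open>Since \<open>k + l \<le> m\<close>, the index ranges at the two ends are disjoint and
  each recursion is solved on its own.\<close>

lemma ex_boundary_coeffs:
  assumes "k + l \<le> m"
  shows "\<exists>r. left_coeffs m k t n p r \<and> right_coeffs m l s t n p r"
proof -
  obtain a where a: "\<And>j. j < k \<Longrightarrow> a j = real (n 1 choose j) * inverse (real (m choose j))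
      * inverse ((t 1 - t 0) ^ j) * fdiff j (p 1) 0 - (\<Sum>h<j. (-1) ^ (j + h) * real (j choose h) * a h)"
    using triangular_system_solvable[of k "\<lambda>j. real (n 1 choose j) * inverse (real (m choose j))
      * inverse ((t 1 - t 0) ^ j) * fdiff j (p 1) 0" "\<lambda>j h. (-1) ^ (j + h) * real (j choose h)"] by blast
  \<comment> \<open>The right end is counted backwards: \<open>b j\<close> stands for
    \<open>r (m - j)\<close>, and the summation index is reflected to \<open>j - h\<close>.\<close>
  obtain b where b: "\<And>j. j < l \<Longrightarrow> b j = (-1) ^ j * real (n s choose j) * inverse (real (m choose j))
      * inverse ((t s - t (s - 1)) ^ j) * fdiff j (p s) (n s - j)
      - (\<Sum>h<j. (-1) ^ (j - h) * real (j choose (j - h)) * b h)"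
    using triangular_system_solvable[of l "\<lambda>j. (-1) ^ j * real (n s choose j) * inverse (real (m choose j))
      * inverse ((t s - t (s - 1)) ^ j) * fdiff j (p s) (n s - j)"
      "\<lambda>j h. (-1) ^ (j - h) * real (j choose (j - h))"] by blast
  define r where "r j = (if j < k then a j else b (m - j))" for j
  have "left_coeffs m k t n p r"
    unfolding left_coeffs_def
  proof (intro allI impI)
    fix j assume j: "j < k"
    have "(\<Sum>h<j. (-1) ^ (j + h) * real (j choose h) * r h) = (\<Sum>h<j. (-1) ^ (j + h) * real (j choose h) * a h)"
      by (rule sum.cong) (use j in \<open>auto simp: r_def\<close>)
    then show "r j = real (n 1 choose j) * inverse (real (m choose j)) * inverse ((t 1 - t 0) ^ j)
        * fdiff j (p 1) 0 - (\<Sum>h<j. (-1) ^ (j + h) * real (j choose h) * r h)"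
      using a[OF j] j by (simp add: r_def[of j])
  qed
  moreover have "right_coeffs m l s t n p r"
    unfolding right_coeffs_def
  proof (intro allI impI)
    fix j assume j: "j < l"
    have rb: "r (m - i) = b i" if "i \<le> j" for i using that j assms by (auto simp: r_def)
    have sum_b: "(\<Sum>h=1..j. (-1) ^ h * real (j choose h) * r (m - j + h)) =
        (\<Sum>h<j. (-1) ^ (j - h) * real (j choose (j - h)) * b h)"
    proof (rule sum.reindex_bij_witness[of _ "\<lambda>h. j - h" "\<lambda>h. j - h"])
      fix h assume h: "h \<in> {1..j}"
      then have "m - j + h = m - (j - h)" using j assms by auto
      then show "(-1) ^ (j - (j - h)) * real (j choose (j - (j - h))) * b (j - h) =
          (-1) ^ h * real (j choose h) * r (m - j + h)"
        using h rb[of "j - h"] by simp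
    qed auto
    show "r (m - j) = (-1) ^ j * real (n s choose j) * inverse (real (m choose j))
        * inverse ((t s - t (s - 1)) ^ j) * fdiff j (p s) (n s - j)
        - (\<Sum>h=1..j. (-1) ^ h * real (j choose h) * r (m - j + h))"
      unfolding sum_b rb[OF order.refl] by (rule b[OF j])
  qed
  ultimately show ?thesis by blast
qed

text \<open>Expanding \<open>bezier m r\<close> separates free from fixed coefficients; the fixed
  ones, evaluated by \<open>inner01_Bernstein\<close>, move to the other side and form the
  correction in \<open>r_hat\<close>.\<close>

lemma orthogonal_iff_r_hat:
  assumes cont: "continuous_on {0..1} P" and kl: "k + l \<le> m" and h: "h \<in> {k..m - l}"
    and P: "inner01 P (Bernstein m h) = (\<Sum>i=1..s. (t i - t (i - 1)) * (\<Sum>v\<le>m. p_hat m n p i v * d_coeff m t i h v))"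
  shows "inner01 (Bernstein m h) (\<lambda>t. bezier m r t - P t) = 0 \<longleftrightarrow>
    (\<Sum>j=k..m - l. r j * inner01 (Bernstein m j) (Bernstein m h)) = r_hat m k l s t n p r h"
proof -
  let ?G = "\<lambda>j. r j * inner01 (Bernstein m j) (Bernstein m h)"
  have split: "{..m} = {..<k} \<union> {k..m - l} \<union> {m - l + 1..m}" and km: "k \<le> m - l" and hm: "h \<le> m"
    using kl h by auto
  have "(\<Sum>j\<le>m. ?G j) = (\<Sum>j<k. ?G j) + (\<Sum>j=k..m - l. ?G j) + (\<Sum>j=m - l + 1..m. ?G j)"
    unfolding split by (subst sum.union_disjoint; (subst sum.union_disjoint)?) (use km in auto)
  moreover have "?G j = 1 / real (2 * m + 1) * real (m choose h) *
      (inverse (real ((2 * m) choose (h + j))) * real (m choose j) * r j)" if "j \<le> m" for j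
    using inner01_Bernstein[of j m h m] that hm by (simp add: mult_2[symmetric] add.commute[of j])
  then have "(\<Sum>j<k. ?G j) + (\<Sum>j=m - l + 1..m. ?G j) = 1 / real (2 * m + 1) * real (m choose h) *
       ((\<Sum>v<k. inverse (real ((2 * m) choose (h + v))) * real (m choose v) * r v)
        + (\<Sum>v=m - l + 1..m. inverse (real ((2 * m) choose (h + v))) * real (m choose v) * r v))"
    unfolding distrib_left sum_distrib_left using kl by (intro arg_cong2[where f = "(+)"] sum.cong) auto
  moreover have "inner01 (Bernstein m h) (\<lambda>t. bezier m r t - P t) = (\<Sum>j\<le>m. ?G j) - inner01 P (Bernstein m h)"
  proof -
    have "inner01 (\<lambda>t. bezier m r t - P t) (Bernstein m h) =
        inner01 (bezier m r) (Bernstein m h) - inner01 P (Bernstein m h)"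
      by (intro inner01_diff_left continuous_intros cont)
    also have "inner01 (bezier m r) (Bernstein m h) = (\<Sum>j\<le>m. ?G j)"
      by (intro inner01_bezier_left continuous_intros)
    finally show ?thesis by (subst inner01_commute)
  qed
  ultimately show ?thesis unfolding r_hat_def P by linarith
qed

section \<open>Assembly over the partition\<close>

lemma partition_inner01_Bernstein:
  assumes t: "t 0 = 0" "t s = 1" "\<And>i. i < s \<Longrightarrow> t i < t (Suc i)"
    and P: "\<And>i x. i \<in> {1..s} \<Longrightarrow> x \<in> {t (i - 1)..t i} \<Longrightarrow>
           P x = bezier (n i) (p i) ((x - t (i - 1)) / (t i - t (i - 1)))"
  shows "continuous_on {0..1} P"
    and "inner01 P (Bernstein m h) =
      (\<Sum>i=1..s. (t i - t (i - 1)) * (\<Sum>v\<le>m. p_hat m n p i v * d_coeff m t i h v))"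
proof -
  have less: "t (i - 1) < t i" if "i \<in> {1..s}" for i using t(3)[of "i - 1"] that by auto
  have cont: "continuous_on {t (i - 1)..t i} P" if i: "i \<in> {1..s}" for i
  proof -
    have "continuous_on {t (i - 1)..t i} (\<lambda>x. bezier (n i) (p i) ((x - t (i - 1)) / (t i - t (i - 1))))"
      using less[OF i] by (intro continuous_intros) auto
    then show ?thesis using P[OF i] by (simp cong: continuous_on_cong_simp)
  qed
  show "continuous_on {0..1} P"
    using integral_partition[of s t P, OF t(3)] cont t(1,2) by auto
  have "inner01 P (Bernstein m h) = (\<Sum>i=1..s. integral {t (i - 1)..t i} (\<lambda>x. P x * Bernstein m h x))"
    using integral_partition[of s t "\<lambda>x. P x * Bernstein m h x"] t
    by (simp add: inner01_def cont[simplified] continuous_intros)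
  also have "\<dots> = (\<Sum>i=1..s. (t i - t (i - 1)) * (\<Sum>v\<le>m. p_hat m n p i v * d_coeff m t i h v))"
  proof (rule sum.cong)
    fix i assume i: "i \<in> {1..s}"
    have "integral {t (i - 1)..t i} (\<lambda>x. P x * Bernstein m h x) = integral {t (i - 1)..t i}
      (\<lambda>x. bezier (n i) (p i) ((x - t (i - 1)) / (t i - t (i - 1))) * Bernstein m h x)"
      by (rule integral_cong) (simp only: P[OF i])
    also have "\<dots> = (t i - t (i - 1)) * (\<Sum>v\<le>m. p_hat m n p i v * d_coeff m t i h v)"
      by (rule integral_segment[OF less[OF i]])
    finally show "integral {t (i - 1)..t i} (\<lambda>x. P x * Bernstein m h x) =
        (t i - t (i - 1)) * (\<Sum>v\<le>m. p_hat m n p i v * d_coeff m t i h v)" .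
  qed simp
  finally show "inner01 P (Bernstein m h) =
      (\<Sum>i=1..s. (t i - t (i - 1)) * (\<Sum>v\<le>m. p_hat m n p i v * d_coeff m t i h v))" .
qed

text \<open>An equivalence over sequences: entries beyond \<open>m\<close> do not enter the error
  and stay free, so the optimal \<open>r\<close> is unique up to them.\<close>

theorem theorem3p1:
  fixes s m k l :: nat
    and t :: "nat \<Rightarrow> real"
    and n :: "nat \<Rightarrow> nat"
    and p :: "nat \<Rightarrow> nat \<Rightarrow> real"
    and P :: "real \<Rightarrow> real"
  assumes "t 0 = 0" and "t s = 1"
    and "\<And>i. i < s \<Longrightarrow> t i < t (Suc i)"
    and "\<And>i x. i \<in> {1..s} \<Longrightarrow> x \<in> {t (i - 1)..t i} \<Longrightarrow>
           P x = bezier (n i) (p i) ((x - t (i - 1)) / (t i - t (i - 1)))"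
    and "\<And>i. i \<in> {1..s} \<Longrightarrow> n i \<le> m"
    and "k \<le> n 1 + 1" and "l \<le> n s + 1" and "k + l \<le> m"
  shows "(\<exists>r. optimal m k l P r) \<and>
    (\<forall>r. optimal m k l P r \<longleftrightarrow>
       left_coeffs m k t n p r \<and>
       right_coeffs m l s t n p r \<and>
       (\<forall>j\<in>{k..m - l}. r j = (\<Sum>h=k..m - l. r_hat m k l s t n p r h * dual_coeff m k l h j)))"
proof -
  have kl: "k \<le> m" "l \<le> m" using assms(8) by auto
  have s: "s \<ge> 1" using assms(1,2) by (cases s) auto
  have mono: "t i \<le> t j" if "i \<le> j" "j \<le> s" for i j
    using that
  proof (induction j rule: dec_induct)
    case (step j)
    then show ?case using assms(3)[of j] by simp
  qed simp
  have t1: "0 < t 1" "t 1 \<le> 1" using assms(1,2) assms(3)[of 0] mono[of 1 s] s by auto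
  have ts: "0 \<le> t (s - 1)" "t (s - 1) < 1" using assms(1,2) assms(3)[of "s - 1"] mono[of 0 "s - 1"] s by auto
  have P1: "P x = bezier (n 1) (p 1) ((x - t 0) / (t 1 - t 0))" if "x \<in> {t 0..t 1}" for x
    using assms(4)[of 1 x] that s by simp
  have Ps: "P x = bezier (n s) (p s) ((x - t (s - 1)) / (t s - t (s - 1)))" if "x \<in> {t (s - 1)..t s}" for x
    using assms(4)[of s x] that s by simp
  have left: "left_coeffs m k t n p r \<longleftrightarrow> (\<forall>j<k. fact m / fact (m - j) * fdiff j r 0 = nderiv01 j P 0)" for r
    by (intro left_coeffs_iff_nderiv01 assms(1,6) t1 P1 kl(1))
  have right: "right_coeffs m l s t n p r \<longleftrightarrow>
      (\<forall>j<l. fact m / fact (m - j) * fdiff j r (m - j) = nderiv01 j P 1)" for r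
    by (intro right_coeffs_iff_nderiv01 assms(2,7) ts Ps kl(2))
  have feas: "feasible m k l P r \<longleftrightarrow> left_coeffs m k t n p r \<and> right_coeffs m l s t n p r" for r
    unfolding feasible_iff_fdiff[OF kl] left right ..
  have cont: "continuous_on {0..1} P"
    by (rule partition_inner01_Bernstein(1)[of t s P n p]) (rule assms(1-4); assumption)+
  have inner: "inner01 P (Bernstein m h) =
      (\<Sum>i=1..s. (t i - t (i - 1)) * (\<Sum>v\<le>m. p_hat m n p i v * d_coeff m t i h v))" for h
    by (rule partition_inner01_Bernstein(2)) (rule assms(1-4); assumption)+
  have opt: "optimal m k l P r \<longleftrightarrow> feasible m k l P r \<and>
      (\<forall>j\<in>{k..m - l}. r j = (\<Sum>h=k..m - l. r_hat m k l s t n p r h * dual_coeff m k l h j))" for r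
  proof -
    have "(\<forall>h\<in>{k..m - l}. inner01 (Bernstein m h) (\<lambda>t. bezier m r t - P t) = 0) \<longleftrightarrow>
      (\<forall>h\<in>{k..m - l}. (\<Sum>j=k..m - l. r j * inner01 (Bernstein m j) (Bernstein m h)) = r_hat m k l s t n p r h)"
      by (intro ball_cong refl orthogonal_iff_r_hat[OF cont assms(8) _ inner])
    then show ?thesis
      unfolding optimal_iff_orthogonal[OF cont assms(8)] dual_coeff_solves[OF assms(8)] by simp
  qed
  obtain r where r: "feasible m k l P r"
    using ex_boundary_coeffs[OF assms(8)] feas by metis
  define r' where "r' j = (if j \<in> {k..m - l} then \<Sum>h=k..m - l. r_hat m k l s t n p r h * dual_coeff m k l h j
    else r j)" for j
  have r': "r' j = r j" if "j < k \<or> j \<in> {m - l + 1..m}" for j using that by (auto simp: r'_def)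
  have "feasible m k l P r'"
    unfolding feasible_iff_agree[OF kl r] using assms(8) by (auto intro!: r')
  \<comment> \<open>No circularity: \<open>r_hat\<close> reads only the outer entries, which
    \<open>r'\<close> shares with \<open>r\<close>, so the formula for the inner ones is
    explicit.\<close>
  moreover have "r_hat m k l s t n p r' h = r_hat m k l s t n p r h" for h
    unfolding r_hat_def
    by (intro arg_cong2[where f = "(-)"] arg_cong2[where f = "(*)"] arg_cong2[where f = "(+)"] sum.cong refl r') auto
  ultimately have "optimal m k l P r'" unfolding opt by (simp add: r'_def)
  then show ?thesis using opt feas by blast
qed

end
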